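(* (Realizability preservation.) Consider one step $\mathcal{U}_h^{n}\mapsto \mathcal{U}_h^{n+1}$ of the limited DG forward--backward Euler scheme (1)--(4) described in the context. Suppose (i) the moment closure is exact; (ii) $v_h:=|\boldsymbol v_h|<1$ for all $\boldsymbol K\in\mathcal T$; (iii) the time step $\Delta t$ satisfies the hyperbolic-type restriction $\Delta t\le\min\{\Delta t_{\boldsymbol x}^{\min},\Delta t_{\varepsilon}^{\min}\}$, with $$\Delta t_{\boldsymbol x}^{\min}:=\min_{\boldsymbol K\in\mathcal T}\min_{i}(1-v_h)\,C^{i}\,|K_{\boldsymbol x}^{i}|,\qquad \Delta t_\varepsilon^{\min}:=\min_{\boldsymbol K\in\mathcal T}(1-v_h)\,C^{\varepsilon}\,|K_\varepsilon|/\varepsilon_{\mathrm H},$$ where the constants $C^{i}=\gamma^{\boldsymbol x}\beta^{i}\hat w_{\hat k}$ and $C^{\varepsilon}=\gamma^{\varepsilon}\hat w_{\hat k}/\alpha^{\varepsilon}$ are independent of the size of the elements in the discretization. Then the scheme is realizability-preserving, i.e., $\mathcal{U}_h^{n+1}\in\mathcal R$ on $\widetilde S^{\boldsymbol K}_{\otimes}$ for all $\boldsymbol K\in\mathcal T$, provided that $\mathcal{U}_h^{n}\in\mathcal R$ on $\widetilde S^{\boldsymbol K}_{\otimes}$ for all $\boldsymbol K\in\mathcal T$.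
   Context: **Moments.** $\mathcal R=\{(\mathcal D,\mathcal I)\in\mathbb R\times\mathbb R^3:\ \mathcal D>0,\ \gamma(\mathcal D,\mathcal I):=\mathcal D-|\mathcal I|\ge0\}$ is the realizable set; it is used both for primitive moments $\mathcal M=(\mathcal D,\mathcal I)$ and for conserved moments $\mathcal U=(\mathcal N,\mathcal G)$. A closure assigns to each $\mathcal M\in\mathcal R$ symmetric tensors $\mathcal K^{ij}=\mathsf k^{ij}(\mathcal M)\mathcal D$ and $\mathcal Q^{ijk}=\mathsf q^{ijk}(\mathcal M)\mathcal D$. The closure is *exact* if, given $(\mathcal D,\mathcal I^i)$, the moments $(\mathcal K^{ij},\mathcal Q^{ijk})$ are such that $\{\mathcal D,\mathcal I^i,\mathcal K^{ij},\mathcal Q^{ijk}\}=\frac1{4\pi}\int_{\mathbb S^2} f\{1,\ell^i,\ell^i\ell^j,\ell^i\ell^j\ell^k\}\,d\omega$ for some nonnegative distribution $f$ on $\mathbb S^2$ (a weighted Dirac delta when $|\mathcal I|=\mathcal D$), where $\ell=\ell(\omega)$ is the unit vector in direction $\omega$. Repeated indices are summed over $1,2,3$; indices are raised/lowered with $\delta_{ij}$. For a velocity $\boldsymbol w$, primitive and conserved moments are related by $\mathcal N=\mathcal D+w^i\mathcal I_i$, $\mathcal G_j=\mathcal I_j+w^i\mathcal K_{ij}$. Given $\mathcal U$ and $\boldsymbol w$, the primitive moments $\mathcal M\in\mathcal R$ solving these relations are computed as the limit of the Picard iteration $\mathcal M\leftarrow\mathcal M-\lambda(\mathcal D+w^i\mathcal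 I_i-\mathcal N,\ \mathcal I_j+w^i\mathsf k_{ij}\mathcal D-\mathcal G_j)$ with $\lambda=(1+|\boldsymbol w|)^{-1}$ and a realizable initial iterate. With this $\mathcal M$, define $\mathcal F^i(\mathcal U,\boldsymbol w)=(\mathcal I^i+w^i\mathcal D,\ \mathcal K^i{}_j+w^i\mathcal I_j)$, $\mathcal F^\varepsilon(\mathcal U,\boldsymbol w)=-(\mathcal K^i{}_k,\ \mathcal Q^i{}_{kj})(\partial_i v^k)_h$, $\mathcal S(\mathcal U,\boldsymbol w)=(0,\ \mathcal Q^i{}_{kj}(\partial_iv^k)_h-\mathcal I^i(\partial_iv_j)_h)$, $\mathcal C(\mathcal U)=(\chi(\mathcal D_0-\mathcal D),\ -\kappa\mathcal I_j)$, where $\kappa=\chi+\sigma$, the opacities $\chi,\sigma\ge0$ are constant on each element, and $\mathcal D_0\ge 0$ is the given zeroth moment of an equilibrium distribution. For another velocity $\boldsymbol w'$, $\mathcal U[\boldsymbol w']$ denotes the conserved moments formed from the same $\mathcal M$ with velocity $\boldsymbol w'$. **Mesh and spaces.** The domain $D_\varepsilon\times D_{\boldsymbol x}$ ($D_{\boldsymbol x}$ of dimension $d_{\boldsymbol x}\le 3$) is divided into tensor-product elements $\boldsymbol K=K_\varepsilon\times\boldsymbol K_{\boldsymbol x}\in\mathcal T$, $\boldsymbol K_{\boldsymbol x}=\prod_iK^i_{\boldsymbol x}$, $K_{\boldsymbol x}^i=(x^i_{\mathrm L},x^i_{\mathrm H})$, $K_\varepsilon=(\varepsilon_{\mathrm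 L},\varepsilon_{\mathrm H})\subset\mathbb R^+$. Write $\tau=\varepsilon^2$, $\boldsymbol z=(\varepsilon,\boldsymbol x)$, $|\boldsymbol K|=\int_{\boldsymbol K}\tau\,d\boldsymbol z$, $|K^i_{\boldsymbol x}|=x^i_{\mathrm H}-x^i_{\mathrm L}$, $|K_\varepsilon|=\varepsilon_{\mathrm H}-\varepsilon_{\mathrm L}$; $\tilde{\boldsymbol K}^i$ is the face of $\boldsymbol K$ orthogonal to $x^i$ (including the energy direction) with coordinates $\tilde{\boldsymbol z}^i$, and $\tilde{\boldsymbol K}^j_{\boldsymbol x}$ is the purely spatial face orthogonal to $x^j$ with coordinates $\tilde{\boldsymbol x}^j$. $\mathbb V_h^k$ is the space of functions that on each element are tensor products of one-dimensional polynomials of degree $\le k$ (with the analogous spatial space $\mathbb V_h^k(\boldsymbol K_{\boldsymbol x})$). $\mathcal U_h$ has components in $\mathbb V_h^k$; the given velocity $\boldsymbol v_h$ has components in $\mathbb V_h^k(\boldsymbol K_{\boldsymbol x})$. $(a,b)_{\boldsymbol K}=\int_{\boldsymbol K}ab\,\tau\,d\boldsymbol z$. Integrals are evaluated with $(k+1)$-point Legendre--Gauss (LG) quadrature in each dimension (tangential dimensions for faces), and the basis is nodal at the LG points, so the collision step acts node by node. The cell average is $\mathcal U_{\boldsymbol K}=(\mathcal U_h,1)_{\boldsymbol K}/|\boldsymbol K|$. **Point sets.** $S^{\boldsymbol K}_{\otimes}$ is the tensor product of the $(k+1)$-point LG points in all dimensions of $\boldsymbol K$. $\widehat S^{\boldsymbol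 K}_{\varepsilon,\otimes}$ (resp. $\widehat S^{\boldsymbol K}_{i,\otimes}$) is obtained from it by replacing the LG points in the $\varepsilon$ (resp. $x^i$) dimension with the $\hat k$-point Legendre--Gauss--Lobatto (LGL) points, $\hat k\ge (k+5)/2$. $\widehat S^{\boldsymbol K}_{\otimes}=\widehat S^{\boldsymbol K}_{\varepsilon,\otimes}\cup\bigcup_i\widehat S^{\boldsymbol K}_{i,\otimes}$ and $\widetilde S^{\boldsymbol K}_{\otimes}=S^{\boldsymbol K}_{\otimes}\cup\widehat S^{\boldsymbol K}_{\otimes}$. $\hat w_{\hat k}$ is the last (endpoint) LGL weight, with weights normalized to sum to $1$. **Advection operator.** $\mathcal B_h(\mathcal U_h,\boldsymbol v_h,\varphi_h)_{\boldsymbol K}$ is $$-\sum_{i=1}^{d_{\boldsymbol x}}\int_{\tilde{\boldsymbol K}^i}\big[\widehat{\mathcal F^i}\varphi_h|_{x_{\mathrm H}^i}-\widehat{\mathcal F^i}\varphi_h|_{x_{\mathrm L}^i}\big]\tau\,d\tilde{\boldsymbol z}^i+\sum_i(\mathcal F^i(\mathcal U_h,\boldsymbol v_h),\partial_i\varphi_h)_{\boldsymbol K}-\int_{\boldsymbol K_{\boldsymbol x}}\big[\varepsilon^3\widehat{\mathcal F^\varepsilon}\varphi_h|_{\varepsilon_{\mathrm H}}-\varepsilon^3\widehat{\mathcal F^\varepsilon}\varphi_h|_{\varepsilon_{\mathrm L}}\big]d\boldsymbol x+(\varepsilon\mathcal F^\varepsilon(\mathcal U_h,\boldsymbol v_h),\partial_\varepsilon\varphi_h)_{\boldsymbol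 K}+(\mathcal S(\mathcal U_h,\boldsymbol v_h),\varphi_h)_{\boldsymbol K}.$$ Here, with $\mathcal U_a,\mathcal U_b$ the left and right traces, the spatial numerical flux is $\widehat{\mathcal F^i}=\frac12\big(\mathcal F^i(\mathcal U_a,\hat{\boldsymbol v})+\mathcal F^i(\mathcal U_b,\hat{\boldsymbol v})-(\mathcal U_b[\hat{\boldsymbol v}^i]-\mathcal U_a[\hat{\boldsymbol v}^i])\big)$, where $\hat{\boldsymbol v}$ is the average of the left and right traces of $\boldsymbol v_h$, $\hat{\boldsymbol v}^i=(\delta^{i1}\hat v^1,\delta^{i2}\hat v^2,\delta^{i3}\hat v^3)$, and the primitive moments of $\mathcal U_a,\mathcal U_b$ are those for velocity $\hat{\boldsymbol v}$. The energy flux is $\widehat{\mathcal F^\varepsilon}=\frac12\big(\mathcal F^\varepsilon(\mathcal U_a,\boldsymbol v_h)+\mathcal F^\varepsilon(\mathcal U_b,\boldsymbol v_h)-\alpha^\varepsilon(\mathcal M_b-\mathcal M_a)\big)$, where $\alpha^\varepsilon$ is the largest absolute eigenvalue of the matrix $A_{ij}=-\frac12((\partial_iv^j)_h+(\partial_jv^i)_h)$. The discrete derivative $(\partial_jv^i)_h\in\mathbb V_h^k(\boldsymbol K_{\boldsymbol x})$ is defined by $\int_{\boldsymbol K_{\boldsymbol x}}(\partial_jv^i)_h\varphi_h\,d\boldsymbol x=\int_{\tilde{\boldsymbol K}^j_{\boldsymbol x}}[\hat v^i\varphi_h|_{x^j_{\mathrm H}}-\hat v^i\varphi_h|_{x^j_{\mathrm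 L}}]\,d\tilde{\boldsymbol x}^j-\int_{\boldsymbol K_{\boldsymbol x}}v^i_h\,\partial_j\varphi_h\,d\boldsymbol x$ for all $\varphi_h\in \mathbb V_h^k(\boldsymbol K_{\boldsymbol x})$. **Scheme.** For all $\varphi_h\in\mathbb V_h^k$ and $\boldsymbol K\in\mathcal T$: (1) $(\widehat{\mathcal U}_h^{n+1/2},\varphi_h)_{\boldsymbol K}=(\mathcal U_h^n,\varphi_h)_{\boldsymbol K}+\Delta t\,\mathcal B_h(\mathcal U_h^n,\boldsymbol v_h,\varphi_h)_{\boldsymbol K}$; (2) $\mathcal U_h^{n+1/2}=\mathrm{Lim}(\widehat{\mathcal U}_h^{n+1/2})$; (3) $(\widehat{\mathcal U}_h^{n+1},\varphi_h)_{\boldsymbol K}=(\mathcal U_h^{n+1/2},\varphi_h)_{\boldsymbol K}+\Delta t\,(\mathcal C(\widehat{\mathcal U}_h^{n+1}),\varphi_h)_{\boldsymbol K}$; (4) $\mathcal U_h^{n+1}=\mathrm{Lim}(\widehat{\mathcal U}_h^{n+1})$. Step (3) is solved at each node: with $(\mathcal N^{*},\mathcal G^{*})=\mathcal U_h^{n+1/2}$ at the node and $v=|\boldsymbol v_h|$ there, $\mathcal M$ is the limit of the Picard iteration $\mathcal D\leftarrow\mu_\chi\big((1-\lambda)\mathcal D+\lambda(-v^i\mathcal I_i+\mathcal N^*+\Delta t\chi\mathcal D_0)\big)$, $\mathcal I_j\leftarrow\mu_\kappa\big((1-\lambda)\mathcal I_j+\lambda(-v^i\mathsf k_{ij}\mathcal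 D+\mathcal G^*_j)\big)$ started in $\mathcal R$, with $\lambda=(1+v)^{-1}$, $\mu_\chi=(1+\lambda\Delta t\chi)^{-1}$, $\mu_\kappa=(1+\lambda\Delta t\kappa)^{-1}$, and $\widehat{\mathcal U}_h^{n+1}$ is the conserved moment of $\mathcal M$. **Limiter $\mathrm{Lim}$** (parameter $0<\delta\ll1$). Input: $\widehat{\mathcal U}_h=(\widehat{\mathcal N}_h,\widehat{\mathcal G}_h)$ whose cell averages $\widehat{\mathcal U}_{\boldsymbol K}=(\widehat{\mathcal N}_{\boldsymbol K},\widehat{\mathcal G}_{\boldsymbol K})$ have $\widehat{\mathcal N}_{\boldsymbol K}>0$ for all $\boldsymbol K$. On each $\boldsymbol K$: if $\widehat{\mathcal U}_{\boldsymbol K}\in\mathcal R$, set $\tilde{\mathcal N}_h=\theta^{\mathcal N}\widehat{\mathcal N}_h+(1-\theta^{\mathcal N})\widehat{\mathcal N}_{\boldsymbol K}$ with $\theta^{\mathcal N}=\min\{\widehat{\mathcal N}_{\boldsymbol K}/(\widehat{\mathcal N}_{\boldsymbol K}-\min_{\boldsymbol z\in\widetilde S^{\boldsymbol K}_\otimes}\widehat{\mathcal N}_h(\boldsymbol z)),1\}$, then $\tilde{\mathcal U}_h=(\tilde{\mathcal N}_h,\widehat{\mathcal G}_h)$, and output $\mathcal U_h=\theta^{\mathcal U}\tilde{\mathcal U}_h+(1-\theta^{\mathcal U})\widehat{\mathcal U}_{\boldsymbol K}$, where $\theta^{\mathcal U}$ is the largest $\theta\in[0,1]$ such that $\gamma(\theta\,\tilde{\mathcal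 U}_h(\boldsymbol z)+(1-\theta)\widehat{\mathcal U}_{\boldsymbol K})\ge0$ for all $\boldsymbol z\in\widetilde S^{\boldsymbol K}_\otimes$. Otherwise, output $\mathcal U_h=(\mathcal N_h,\mathcal G_h)$ with $\mathcal N_h=\widehat{\mathcal N}_{\boldsymbol K}$ and $\mathcal G_h=(1-\delta)\widehat{\mathcal N}_{\boldsymbol K}\,\widehat{\mathcal G}_h/|\widehat{\mathcal G}_h|$. **Constants.** $\gamma^{\boldsymbol x},\gamma^\varepsilon,\gamma^{\mathcal S}>0$ with $\gamma^{\boldsymbol x}+\gamma^\varepsilon+\gamma^{\mathcal S}=1$; $\beta^i>0$ with $\sum_{i=1}^{d_{\boldsymbol x}}\beta^i=1$.
   Formalization: Added: where the number density entering the final limiter (4) is ≤ 0 on the point set, its flux is nonzero (else the limiter can return (0,0), outside R). In (ii) and (iii), v_h also ranges over the face velocities v̂; boundary traces are given realizable data. *)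

theory Defs
  imports "HOL-Analysis.Analysis" "HOL-Computational_Algebra.Polynomial"
begin

section \<open>Moments and closures\<close>

type_synonym vec3 = "real ^ 3"

type_synonym moments = "real \<times> vec3"

definition gam :: "moments \<Rightarrow> real" where
  "gam M = fst M - norm (snd M)"

definition realizable :: "moments set" where
  "realizable = {M. fst M > 0 \<and> gam M \<ge> 0}"

text \<open>A closure is given by its two normalised tensors \<open>k\<close> and \<open>q\<close> as functions of the
  primitive moments.\<close>

record closure =
  kfun :: "moments \<Rightarrow> real ^ 3 ^ 3"
  qfun :: "moments \<Rightarrow> real ^ 3 ^ 3 ^ 3"

definition Kten :: "closure \<Rightarrow> moments \<Rightarrow> real ^ 3 ^ 3" where
  "Kten cl M = fst M *\<^sub>R kfun cl M"

definition Qten :: "closure \<Rightarrow> moments \<Rightarrow> real ^ 3 ^ 3 ^ 3" where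
  "Qten cl M = fst M *\<^sub>R qfun cl M"

text \<open>A nonnegative distribution on the unit sphere is a finite Borel measure \<open>\<mu>\<close> standing for
  \<open>f d\<omega>\<close>. This includes the weighted Dirac measures, which are the only possibility when
  \<open>norm (snd M) = fst M\<close>. Symmetry of the tensors on realizable moments is a consequence.\<close>

definition exact_closure :: "closure \<Rightarrow> bool" where
  "exact_closure cl \<longleftrightarrow> (\<forall>M\<in>realizable. \<exists>\<mu> :: vec3 measure.
     sets \<mu> = sets (restrict_space borel (sphere 0 1)) \<and> finite_measure \<mu> \<and>
     fst M = 1 / (4 * pi) * (LINT l|\<mu>. 1) \<and>
     (\<forall>i. snd M $ i = 1 / (4 * pi) * (LINT l|\<mu>. l $ i)) \<and>
     (\<forall>i j. Kten cl M $ i $ j = 1 / (4 * pi) * (LINT l|\<mu>. l $ i * l $ j)) \<and>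
     (\<forall>i j k. Qten cl M $ i $ j $ k = 1 / (4 * pi) * (LINT l|\<mu>. l $ i * l $ j * l $ k)))"

definition conserved :: "closure \<Rightarrow> vec3 \<Rightarrow> moments \<Rightarrow> moments" where
  "conserved cl w M =
     (fst M + w \<bullet> snd M, \<chi> j. snd M $ j + (\<Sum>i\<in>UNIV. w $ i * Kten cl M $ i $ j))"

definition picard :: "closure \<Rightarrow> moments \<Rightarrow> vec3 \<Rightarrow> moments \<Rightarrow> moments" where
  "picard cl U w M = M - (1 / (1 + norm w)) *\<^sub>R (conserved cl w M - U)"

text \<open>Realizability of \<open>M\<close> itself is deliberately not part of this definition.\<close>

definition is_primitive :: "closure \<Rightarrow> moments \<Rightarrow> vec3 \<Rightarrow> moments \<Rightarrow> bool" where
  "is_primitive cl U w M \<longleftrightarrow> conserved cl w M = U \<and>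
     (\<exists>M0\<in>realizable. (\<lambda>n. (picard cl U w ^^ n) M0) \<longlonglongrightarrow> M)"

text \<open>Fluxes and sources as functions of the primitive moments. In the gradient argument \<open>dv\<close>,
  the entry \<open>dv $ i $ k\<close> is the derivative of the \<open>k\<close>-th velocity component in
  direction \<open>i\<close>.\<close>

definition Fx :: "closure \<Rightarrow> 3 \<Rightarrow> vec3 \<Rightarrow> moments \<Rightarrow> moments" where
  "Fx cl i w M = (snd M $ i + w $ i * fst M, \<chi> j. Kten cl M $ i $ j + w $ i * snd M $ j)"

definition Feps :: "closure \<Rightarrow> real ^ 3 ^ 3 \<Rightarrow> moments \<Rightarrow> moments" where
  "Feps cl dv M =
     - (\<Sum>i\<in>UNIV. \<Sum>k\<in>UNIV. Kten cl M $ i $ k * dv $ i $ k,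
        \<chi> j. \<Sum>i\<in>UNIV. \<Sum>k\<in>UNIV. Qten cl M $ i $ k $ j * dv $ i $ k)"

definition Ssrc :: "closure \<Rightarrow> real ^ 3 ^ 3 \<Rightarrow> moments \<Rightarrow> moments" where
  "Ssrc cl dv M =
     (0, \<chi> j. (\<Sum>i\<in>UNIV. \<Sum>k\<in>UNIV. Qten cl M $ i $ k $ j * dv $ i $ k)
            - (\<Sum>i\<in>UNIV. snd M $ i * dv $ i $ j))"

definition Ccol :: "real \<Rightarrow> real \<Rightarrow> real \<Rightarrow> moments \<Rightarrow> moments" where
  "Ccol chi kap D0 M = (chi * (D0 - fst M), - kap *\<^sub>R snd M)"

definition Amat :: "real ^ 3 ^ 3 \<Rightarrow> real ^ 3 ^ 3" where
  "Amat dv = (\<chi> i j. - (1 / 2) * (dv $ i $ j + dv $ j $ i))"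

definition alpha_eps :: "real ^ 3 ^ 3 \<Rightarrow> real" where
  "alpha_eps dv = Max {\<bar>l\<bar> | l. \<exists>x. x \<noteq> 0 \<and> Amat dv *v x = l *\<^sub>R x}"


section \<open>Legendre--Gauss and Legendre--Gauss--Lobatto quadrature\<close>

definition legendre :: "nat \<Rightarrow> real poly" where
  "legendre n = smult (1 / (2 ^ n * fact n)) ((pderiv ^^ n) ([:-1, 0, 1:] ^ n))"

definition lg_nodes :: "nat \<Rightarrow> real \<Rightarrow> real \<Rightarrow> real set" where
  "lg_nodes n a b = (\<lambda>s. (a + b) / 2 + (b - a) / 2 * s) ` {s. poly (legendre n) s = 0}"

definition lgl_nodes :: "nat \<Rightarrow> real \<Rightarrow> real \<Rightarrow> real set" where
  "lgl_nodes n a b = (\<lambda>s. (a + b) / 2 + (b - a) / 2 * s) `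
     ({-1, 1} \<union> {s. poly (pderiv (legendre (n - 1))) s = 0})"

text \<open>Interpolatory weight of the node \<open>x\<close> among the nodes \<open>X\<close> on \<open>[a, b]\<close>, normalised so that
  the weights sum to 1.\<close>

definition qweight :: "real set \<Rightarrow> real \<Rightarrow> real \<Rightarrow> real \<Rightarrow> real" where
  "qweight X a b x = 1 / (b - a) * integral {a..b} (\<lambda>t. \<Prod>y\<in>X - {x}. (t - y) / (x - y))"

definition lgl_end_weight :: "nat \<Rightarrow> real" where
  "lgl_end_weight n = qweight (lgl_nodes n (-1) 1) (-1) 1 1"


section \<open>Boxes, tensor-product quadrature and polynomials\<close>

text \<open>Phase-space coordinates: \<open>None\<close> is the energy coordinate and \<open>Some i\<close> the spatial coordinate
  \<open>i\<close>. In fewer than three spatial dimensions the unused coordinates of points and boxes are 0; so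
  is the energy coordinate of purely spatial points and boxes. A box is a pair of lower and upper
  corner.\<close>

type_synonym coord = "3 option"
type_synonym point = "real ^ (3 option)"
type_synonym cell = "point \<times> point"

definition upd :: "point \<Rightarrow> coord \<Rightarrow> real \<Rightarrow> point" where
  "upd z c s = (\<chi> c'. if c' = c then s else z $ c')"

definition spat :: "point \<Rightarrow> point" where
  "spat z = upd z None 0"

definition sbox :: "cell \<Rightarrow> cell" where
  "sbox K = (spat (fst K), spat (snd K))"

definition face :: "cell \<Rightarrow> coord \<Rightarrow> bool \<Rightarrow> real" where
  "face K c up = (if up then snd K $ c else fst K $ c)"

definition width :: "cell \<Rightarrow> coord \<Rightarrow> real" where
  "width K c = snd K $ c - fst K $ c"

definition open_box :: "coord set \<Rightarrow> cell \<Rightarrow> point set" where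
  "open_box C K = {z. (\<forall>c\<in>C. fst K $ c < z $ c \<and> z $ c < snd K $ c) \<and> (\<forall>c. c \<notin> C \<longrightarrow> z $ c = 0)}"

definition closed_box :: "cell \<Rightarrow> point set" where
  "closed_box K = cbox (fst K) (snd K)"

definition tnodes :: "nat \<Rightarrow> coord set \<Rightarrow> cell \<Rightarrow> point set" where
  "tnodes k C K = {z. (\<forall>c\<in>C. z $ c \<in> lg_nodes (k + 1) (fst K $ c) (snd K $ c)) \<and>
                      (\<forall>c. c \<notin> C \<longrightarrow> z $ c = 0)}"

definition tnodes_lgl :: "nat \<Rightarrow> nat \<Rightarrow> coord set \<Rightarrow> coord \<Rightarrow> cell \<Rightarrow> point set" where
  "tnodes_lgl k kh C c K = {z. z $ c \<in> lgl_nodes kh (fst K $ c) (snd K $ c) \<and>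
      (\<forall>c'\<in>C - {c}. z $ c' \<in> lg_nodes (k + 1) (fst K $ c') (snd K $ c')) \<and>
      (\<forall>c'. c' \<notin> C \<longrightarrow> z $ c' = 0)}"

definition all_points :: "nat \<Rightarrow> nat \<Rightarrow> coord set \<Rightarrow> cell \<Rightarrow> point set" where
  "all_points k kh C K = tnodes k C K \<union> (\<Union>c\<in>C. tnodes_lgl k kh C c K)"

text \<open>The \<open>(k+1)\<close>-point tensor-product LG approximation of the integral of \<open>g\<close> over the
  coordinates \<open>C\<close> of \<open>K\<close>.\<close>

definition tquad :: "nat \<Rightarrow> coord set \<Rightarrow> cell \<Rightarrow> (point \<Rightarrow> 'a::real_vector) \<Rightarrow> 'a" where
  "tquad k C K g = (\<Sum>z\<in>tnodes k C K.
     (\<Prod>c\<in>C. width K c *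
        qweight (lg_nodes (k + 1) (fst K $ c) (snd K $ c)) (fst K $ c) (snd K $ c) (z $ c)) *\<^sub>R g z)"

definition fquad :: "nat \<Rightarrow> coord set \<Rightarrow> cell \<Rightarrow> coord \<Rightarrow> bool \<Rightarrow> (point \<Rightarrow> 'a::real_vector) \<Rightarrow> 'a" where
  "fquad k C K c up g = tquad k (C - {c}) K (\<lambda>z. g (upd z c (face K c up)))"

definition tau :: "point \<Rightarrow> real" where
  "tau z = (z $ None)\<^sup>2"

definition ip :: "nat \<Rightarrow> coord set \<Rightarrow> cell \<Rightarrow> (point \<Rightarrow> 'a::real_vector) \<Rightarrow> (point \<Rightarrow> real) \<Rightarrow> 'a" where
  "ip k C K f phi = tquad k C K (\<lambda>z. (tau z * phi z) *\<^sub>R f z)"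

definition cell_avg :: "nat \<Rightarrow> coord set \<Rightarrow> cell \<Rightarrow> (point \<Rightarrow> 'a::real_vector) \<Rightarrow> 'a" where
  "cell_avg k C K f = (1 / tquad k C K tau) *\<^sub>R ip k C K f (\<lambda>z. 1)"

definition tensor_poly :: "nat \<Rightarrow> coord set \<Rightarrow> (point \<Rightarrow> real) \<Rightarrow> bool" where
  "tensor_poly k C p \<longleftrightarrow>
     (\<exists>a. \<forall>z. p z = (\<Sum>m\<in>PiE C (\<lambda>_. {..k}). a m * (\<Prod>c\<in>C. z $ c ^ m c)))"

definition moments_poly :: "nat \<Rightarrow> coord set \<Rightarrow> (point \<Rightarrow> moments) \<Rightarrow> bool" where
  "moments_poly k C U \<longleftrightarrow>
     tensor_poly k C (\<lambda>z. fst (U z)) \<and> (\<forall>j. tensor_poly k C (\<lambda>z. snd (U z) $ j))"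

definition pd :: "coord \<Rightarrow> (point \<Rightarrow> real) \<Rightarrow> point \<Rightarrow> real" where
  "pd c p z = deriv (\<lambda>s. p (upd z c s)) (z $ c)"


section \<open>Discretization data\<close>

text \<open>The elements are \<open>K\<^sub>\<epsilon> \<times> K\<^sub>x\<close> with \<open>K\<^sub>\<epsilon>\<close> in \<open>emesh\<close> and \<open>K\<^sub>x\<close> in \<open>xmesh\<close>; the domain is the
  union of their closures. Fields are given elementwise, as functions of the element and the point,
  so that the values on the closed element are the traces from inside. On faces in the domain
  boundary the missing outer traces are the boundary data \<open>bU\<close>, \<open>bv\<close> (periodicity is a special
  case). \<open>prim\<close> selects the primitive moments; \<open>dvel\<close> is the discrete velocity gradient, with the
  index convention of \<open>Feps\<close>.\<close>

record dgdata =
  dx :: nat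
  deg :: nat
  nlgl :: nat
  emesh :: "(real \<times> real) set"
  xmesh :: "cell set"
  clos :: closure
  prim :: "moments \<Rightarrow> vec3 \<Rightarrow> moments"
  vel :: "cell \<Rightarrow> point \<Rightarrow> vec3"
  dvel :: "cell \<Rightarrow> point \<Rightarrow> real ^ 3 ^ 3"
  bU :: "cell \<Rightarrow> coord \<Rightarrow> bool \<Rightarrow> point \<Rightarrow> moments"
  bv :: "cell \<Rightarrow> coord \<Rightarrow> bool \<Rightarrow> point \<Rightarrow> vec3"
  chiop :: "cell \<Rightarrow> real"
  sigop :: "cell \<Rightarrow> real"
  Deq :: "cell \<Rightarrow> point \<Rightarrow> real"
  tstep :: real
  limpar :: real

text \<open>The numeral type \<open>3\<close> has \<open>3 = 0\<close>, so \<open>of_nat\<close> maps \<open>{1..3}\<close> bijectively onto it.\<close>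

definition xdims :: "dgdata \<Rightarrow> 3 set" where
  "xdims S = of_nat ` {1..dx S}"

definition xcoords :: "dgdata \<Rightarrow> coord set" where
  "xcoords S = Some ` xdims S"

definition coords :: "dgdata \<Rightarrow> coord set" where
  "coords S = insert None (xcoords S)"

definition cells :: "dgdata \<Rightarrow> cell set" where
  "cells S = {(upd (fst B) None (fst e), upd (snd B) None (snd e)) | e B. e \<in> emesh S \<and> B \<in> xmesh S}"

definition points :: "dgdata \<Rightarrow> cell \<Rightarrow> point set" where
  "points S K = all_points (deg S) (nlgl S) (coords S) K"

definition adjacent :: "cell \<Rightarrow> coord \<Rightarrow> bool \<Rightarrow> cell \<Rightarrow> bool" where
  "adjacent K c up K' \<longleftrightarrow> face K' c (\<not> up) = face K c up \<and>
     (\<forall>c'. c' \<noteq> c \<longrightarrow> fst K' $ c' = fst K $ c' \<and> snd K' $ c' = snd K $ c')"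

text \<open>Conformity: elements whose faces overlap share the whole face. For the energy direction this
  holds by the product structure.\<close>

definition mesh :: "dgdata \<Rightarrow> bool" where
  "mesh S \<longleftrightarrow> dx S \<in> {1..3} \<and>
     finite (emesh S) \<and> emesh S \<noteq> {} \<and> finite (xmesh S) \<and> xmesh S \<noteq> {} \<and>
     (\<forall>e\<in>emesh S. 0 \<le> fst e \<and> fst e < snd e) \<and>
     (\<forall>e\<in>emesh S. \<forall>e'\<in>emesh S. e \<noteq> e' \<longrightarrow> {fst e<..<snd e} \<inter> {fst e'<..<snd e'} = {}) \<and>
     (\<forall>B\<in>xmesh S. (\<forall>c\<in>xcoords S. fst B $ c < snd B $ c) \<and>
                   (\<forall>c. c \<notin> xcoords S \<longrightarrow> fst B $ c = 0 \<and> snd B $ c = 0)) \<and>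
     (\<forall>B\<in>xmesh S. \<forall>B'\<in>xmesh S. B \<noteq> B' \<longrightarrow>
        open_box (xcoords S) B \<inter> open_box (xcoords S) B' = {}) \<and>
     (\<forall>B\<in>xmesh S. \<forall>B'\<in>xmesh S. \<forall>c\<in>xcoords S.
        face B c True = face B' c False \<and>
        (\<forall>c'\<in>xcoords S - {c}. max (fst B $ c') (fst B' $ c') < min (snd B $ c') (snd B' $ c')) \<longrightarrow>
        adjacent B c True B')"

text \<open>The neighbour across a face is unique in a mesh.\<close>

definition outer :: "cell set \<Rightarrow> (cell \<Rightarrow> point \<Rightarrow> 'a) \<Rightarrow> (cell \<Rightarrow> coord \<Rightarrow> bool \<Rightarrow> point \<Rightarrow> 'a) \<Rightarrow>
    cell \<Rightarrow> coord \<Rightarrow> bool \<Rightarrow> point \<Rightarrow> 'a" where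
  "outer T f bd K c up z =
     (if \<exists>K'\<in>T. adjacent K c up K' then f (SOME K'. K' \<in> T \<and> adjacent K c up K') z
      else bd K c up z)"

definition vhat :: "dgdata \<Rightarrow> cell \<Rightarrow> 3 \<Rightarrow> bool \<Rightarrow> point \<Rightarrow> vec3" where
  "vhat S B i up z =
     (1 / 2) *\<^sub>R (vel S B z + outer (xmesh S) (vel S) (bv S) B (Some i) up z)"

text \<open>All velocities that are used on an element: the values of \<open>vel\<close> on the closed element and the
  single-valued velocities on its faces.\<close>

definition velocities :: "dgdata \<Rightarrow> cell \<Rightarrow> vec3 set" where
  "velocities S B = vel S B ` closed_box B \<union>
     {vhat S B i up z | i up z. i \<in> xdims S \<and> z \<in> closed_box B \<and> z $ Some i = face B (Some i) up}"

definition velocity_space :: "dgdata \<Rightarrow> bool" where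
  "velocity_space S \<longleftrightarrow>
     (\<forall>B\<in>xmesh S. \<forall>i. tensor_poly (deg S) (xcoords S) (\<lambda>z. vel S B z $ i))"

definition discrete_gradient :: "dgdata \<Rightarrow> bool" where
  "discrete_gradient S \<longleftrightarrow> (\<forall>B\<in>xmesh S. \<forall>i j.
     (j \<in> xdims S \<longrightarrow>
        tensor_poly (deg S) (xcoords S) (\<lambda>x. dvel S B x $ j $ i) \<and>
        (\<forall>phi. tensor_poly (deg S) (xcoords S) phi \<longrightarrow>
           tquad (deg S) (xcoords S) B (\<lambda>x. dvel S B x $ j $ i * phi x) =
             fquad (deg S) (xcoords S) B (Some j) True (\<lambda>x. vhat S B j True x $ i * phi x)
           - fquad (deg S) (xcoords S) B (Some j) False (\<lambda>x. vhat S B j False x $ i * phi x)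
           - tquad (deg S) (xcoords S) B (\<lambda>x. vel S B x $ i * pd (Some j) phi x))) \<and>
     (j \<notin> xdims S \<longrightarrow> (\<forall>x. dvel S B x $ j $ i = 0)))"

definition boundary_realizable :: "dgdata \<Rightarrow> bool" where
  "boundary_realizable S \<longleftrightarrow> (\<forall>K\<in>cells S. \<forall>c\<in>coords S. \<forall>up.
     \<not> (\<exists>K'\<in>cells S. adjacent K c up K') \<longrightarrow>
     (\<forall>z\<in>tnodes (deg S) (coords S - {c}) K.
        bU S K c up (upd z c (face K c up)) \<in> realizable))"


section \<open>The scheme\<close>

definition flux_x :: "dgdata \<Rightarrow> (cell \<Rightarrow> point \<Rightarrow> moments) \<Rightarrow> cell \<Rightarrow> 3 \<Rightarrow> bool \<Rightarrow> point \<Rightarrow> moments" where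
  "flux_x S U K i up z =
     (let w = vhat S (sbox K) i up (spat z);
          wi = axis i (w $ i);
          Uin = U K z;
          Uout = outer (cells S) U (bU S) K (Some i) up z;
          Ma = prim S (if up then Uin else Uout) w;
          Mb = prim S (if up then Uout else Uin) w
      in (1 / 2) *\<^sub>R (Fx (clos S) i w Ma + Fx (clos S) i w Mb
                      - (conserved (clos S) wi Mb - conserved (clos S) wi Ma)))"

definition flux_eps :: "dgdata \<Rightarrow> (cell \<Rightarrow> point \<Rightarrow> moments) \<Rightarrow> cell \<Rightarrow> bool \<Rightarrow> point \<Rightarrow> moments" where
  "flux_eps S U K up z =
     (let w = vel S (sbox K) (spat z);
          dv = dvel S (sbox K) (spat z);
          Uin = U K z;
          Uout = outer (cells S) U (bU S) K None up z;
          Ma = prim S (if up then Uin else Uout) w;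
          Mb = prim S (if up then Uout else Uin) w
      in (1 / 2) *\<^sub>R (Feps (clos S) dv Ma + Feps (clos S) dv Mb - alpha_eps dv *\<^sub>R (Mb - Ma)))"

definition Bh :: "dgdata \<Rightarrow> (cell \<Rightarrow> point \<Rightarrow> moments) \<Rightarrow> (point \<Rightarrow> real) \<Rightarrow> cell \<Rightarrow> moments" where
  "Bh S U phi K =
     (let k = deg S; C = coords S;
          v = (\<lambda>z. vel S (sbox K) (spat z));
          dv = (\<lambda>z. dvel S (sbox K) (spat z));
          M = (\<lambda>z. prim S (U K z) (v z))
      in - (\<Sum>i\<in>xdims S.
              fquad k C K (Some i) True (\<lambda>z. (tau z * phi z) *\<^sub>R flux_x S U K i True z)
            - fquad k C K (Some i) False (\<lambda>z. (tau z * phi z) *\<^sub>R flux_x S U K i False z))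
         + (\<Sum>i\<in>xdims S. ip k C K (\<lambda>z. Fx (clos S) i (v z) (M z)) (pd (Some i) phi))
         - (fquad k C K None True (\<lambda>z. (z $ None ^ 3 * phi z) *\<^sub>R flux_eps S U K True z)
            - fquad k C K None False (\<lambda>z. (z $ None ^ 3 * phi z) *\<^sub>R flux_eps S U K False z))
         + ip k C K (\<lambda>z. z $ None *\<^sub>R Feps (clos S) (dv z) (M z)) (pd None phi)
         + ip k C K (\<lambda>z. Ssrc (clos S) (dv z) (M z)) phi)"

definition advection_step ::
    "dgdata \<Rightarrow> (cell \<Rightarrow> point \<Rightarrow> moments) \<Rightarrow> (cell \<Rightarrow> point \<Rightarrow> moments) \<Rightarrow> bool" where
  "advection_step S U V \<longleftrightarrow> (\<forall>K\<in>cells S.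
     moments_poly (deg S) (coords S) (V K) \<and>
     (\<forall>phi. tensor_poly (deg S) (coords S) phi \<longrightarrow>
        ip (deg S) (coords S) K (V K) phi =
        ip (deg S) (coords S) K (U K) phi + tstep S *\<^sub>R Bh S U phi K))"

definition implicit_picard ::
    "dgdata \<Rightarrow> real \<Rightarrow> real \<Rightarrow> real \<Rightarrow> moments \<Rightarrow> vec3 \<Rightarrow> moments \<Rightarrow> moments" where
  "implicit_picard S chi kap D0 Ustar w M =
     (let lam = 1 / (1 + norm w);
          muchi = 1 / (1 + lam * tstep S * chi);
          mukap = 1 / (1 + lam * tstep S * kap)
      in (muchi * ((1 - lam) * fst M + lam * (- (w \<bullet> snd M) + fst Ustar + tstep S * chi * D0)),
          \<chi> j. mukap * ((1 - lam) * snd M $ j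
                 + lam * (- (\<Sum>i\<in>UNIV. w $ i * Kten (clos S) M $ i $ j) + snd Ustar $ j))))"

text \<open>\<open>P\<close> collects the primitive moments of the new solution at the LG nodes.\<close>

definition collision_step ::
    "dgdata \<Rightarrow> (cell \<Rightarrow> point \<Rightarrow> moments) \<Rightarrow> (cell \<Rightarrow> point \<Rightarrow> moments) \<Rightarrow> bool" where
  "collision_step S U V \<longleftrightarrow> (\<exists>P. \<forall>K\<in>cells S.
     moments_poly (deg S) (coords S) (V K) \<and>
     (\<forall>z\<in>tnodes (deg S) (coords S) K.
        (\<exists>M0\<in>realizable.
           (\<lambda>n. (implicit_picard S (chiop S K) (chiop S K + sigop S K) (Deq S K z) (U K z)
                   (vel S (sbox K) (spat z)) ^^ n) M0) \<longlonglongrightarrow> P K z) \<and>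
        V K z = conserved (clos S) (vel S (sbox K) (spat z)) (P K z)) \<and>
     (\<forall>phi. tensor_poly (deg S) (coords S) phi \<longrightarrow>
        ip (deg S) (coords S) K (V K) phi =
        ip (deg S) (coords S) K (U K) phi +
        tstep S *\<^sub>R ip (deg S) (coords S) K
          (\<lambda>z. Ccol (chiop S K) (chiop S K + sigop S K) (Deq S K z) (P K z)) phi))"

text \<open>In both branches division by zero is harmless: \<open>Nmin = fst A\<close> only occurs when the density
  is constant, and a vanishing flux stays zero in the second branch. The normalisation there is
  pointwise.\<close>

definition limiter :: "dgdata \<Rightarrow> cell \<Rightarrow> (point \<Rightarrow> moments) \<Rightarrow> point \<Rightarrow> moments" where
  "limiter S K U =
     (let A = cell_avg (deg S) (coords S) K U;
          Nmin = Min ((\<lambda>z. fst (U z)) ` points S K);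
          thN = min (fst A / (fst A - Nmin)) 1;
          V = (\<lambda>z. (thN * fst (U z) + (1 - thN) * fst A, snd (U z)));
          thU = (GREATEST th. 0 \<le> th \<and> th \<le> 1 \<and>
                   (\<forall>z\<in>points S K. gam (th *\<^sub>R V z + (1 - th) *\<^sub>R A) \<ge> 0))
      in if A \<in> realizable then (\<lambda>z. thU *\<^sub>R V z + (1 - thU) *\<^sub>R A)
         else (\<lambda>z. (fst A, ((1 - limpar S) * fst A / norm (snd (U z))) *\<^sub>R snd (U z))))"


section \<open>Time step restriction\<close>

text \<open>Extended reals are used because \<open>C\<^sub>\<epsilon>\<close> is infinite where \<open>\<alpha>\<^sub>\<epsilon>\<close> vanishes
  (a positive number divided by 0 is \<open>\<infinity>\<close> in \<^typ>\<open>ereal\<close>).\<close>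

definition dt_x :: "dgdata \<Rightarrow> real \<Rightarrow> (3 \<Rightarrow> real) \<Rightarrow> ereal" where
  "dt_x S gx beta = (INF K\<in>cells S. INF i\<in>xdims S. INF w\<in>velocities S (sbox K).
     ereal ((1 - norm w) * (gx * beta i * lgl_end_weight (nlgl S)) * width K (Some i)))"

definition dt_eps :: "dgdata \<Rightarrow> real \<Rightarrow> ereal" where
  "dt_eps S ge = (INF K\<in>cells S. INF x\<in>closed_box (sbox K).
     ereal (1 - norm (vel S (sbox K) x)) *
     (ereal (ge * lgl_end_weight (nlgl S)) / ereal (alpha_eps (dvel S (sbox K) x))) *
     ereal (width K None / snd K $ None))"

end

theory Submission
  imports Defs
begin

text \<open>
  The closed cone \<open>gam M \<ge> 0\<close> consists of the densities and fluxes of nonnegative distributions.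
  The limiter returns the solution to it whenever the density average of each element is
  nonnegative. The time step bound guarantees this: the outflow through the faces does not exceed
  the mass that a quadrature rule assigns to these faces.

  \<^bold>\<open>Closure.\<close> For an exact closure, an inequality between moments of order at most two holds as soon
  as the corresponding quadratic polynomial in the direction \<open>l\<close> is nonnegative on the unit sphere
  (\<open>closure_positivity\<close>). For the polynomial \<open>(norm w - w \<bullet> l) * (1 - u \<bullet> l)\<close> this says that both
  Picard iterations map the cone into itself (\<open>implicit_picard_cone\<close>), so that all primitive moments
  lie in the cone. For \<open>alpha_eps \<plusminus> l \<bullet> (Amat *v l)\<close> it bounds the energy flux of the
  density by \<open>alpha_eps\<close> times the density (\<open>energy_flux_bound\<close>).

  \<^bold>\<open>Advection.\<close> Only the density average matters: if the flux average violates realizability, the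
  limiter replaces the flux. The source does not act on the density, so testing with the constant 1
  leaves the face fluxes. Each of them splits into an inflow, which helps, and an outflow. In one
  coordinate, the Gauss rule that computes the element mass agrees with a Gauss--Lobatto rule (up to
  an inequality in the lowest degree, see \<open>lg_average_energy_ge_ends\<close>). The latter has positive
  weights, and the end points are among its nodes. Hence the element mass dominates the end-point
  weight times the mass on the two faces (\<open>tquad_ge_faces\<close>), and the time step bound makes this
  dominate the outflow (\<open>spatial_flux_le\<close>, \<open>energy_flux_le\<close>, \<open>face_balance\<close>).
  Distributing the element mass over the faces with the factors \<open>gx * beta i\<close> and \<open>ge\<close> gives \<open>advected_density_nonneg\<close>.

  \<^bold>\<open>Limiter and collision.\<close> A nonnegative density average is enough for the limited solution to lie
  in the closed cone at all points (\<open>limiter_cone\<close>). The collision step keeps the nodal values in the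
  cone, and the nondegeneracy hypothesis excludes the vertex 0, so the nodal densities, and with them
  their average, are positive. The second limiting then excludes the vertex at all points
  (\<open>limiter_realizable\<close>).
\<close>

section \<open>Integration of polynomials over the reference interval\<close>

definition ref_integral :: "real poly \<Rightarrow> real" where
  "ref_integral p = integral {-1..1} (poly p)"

lemma poly_integrable: "(poly p) integrable_on {a..b::real}"
  by (intro integrable_continuous_real continuous_intros)

lemma ref_integral_0 [simp]: "ref_integral 0 = 0"
  unfolding ref_integral_def by (rule integral_unique, rule has_integral_eq[of _ "\<lambda>_. 0"]) auto

lemma ref_integral_add: "ref_integral (p + q) = ref_integral p + ref_integral q"
proof -
  have "poly (p + q) = (\<lambda>t. poly p t + poly q t)" by auto
  then show ?thesis by (simp add: ref_integral_def integral_add poly_integrable)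
qed

lemma ref_integral_smult: "ref_integral (smult c p) = c * ref_integral p"
proof -
  have "poly (smult c p) = (\<lambda>t. c * poly p t)" by auto
  then show ?thesis by (simp add: ref_integral_def)
qed

lemma ref_integral_sum: "ref_integral (\<Sum>x\<in>A. f x) = (\<Sum>x\<in>A. ref_integral (f x))"
  by (induction A rule: infinite_finite_induct) (simp_all add: ref_integral_add)

lemma ref_integral_pderiv: "ref_integral (pderiv p) = poly p 1 - poly p (-1)"
proof -
  have "((poly (pderiv p)) has_integral (poly p 1 - poly p (-1))) {-1..1}"
    by (intro fundamental_theorem_of_calculus)
       (auto simp flip: has_real_derivative_iff_has_vector_derivative
             intro!: DERIV_subset[OF poly_DERIV])
  then show ?thesis by (simp add: ref_integral_def integral_unique)
qed

lemma ref_integral_by_parts: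
  "ref_integral (pderiv f * g) = poly f 1 * poly g 1 - poly f (-1) * poly g (-1) - ref_integral (f * pderiv g)"
proof -
  have "ref_integral (pderiv (f * g)) = ref_integral (pderiv f * g) + ref_integral (f * pderiv g)"
    by (simp add: pderiv_mult ref_integral_add mult.commute)
  then show ?thesis by (simp add: ref_integral_pderiv)
qed

lemma ref_integral_pos:
  assumes nn: "\<And>t. -1 \<le> t \<Longrightarrow> t \<le> 1 \<Longrightarrow> poly p t \<ge> 0" and "p \<noteq> 0"
  shows "ref_integral p > 0"
proof -
  have ge: "ref_integral p \<ge> 0"
    unfolding ref_integral_def using nn by (intro integral_nonneg poly_integrable) auto
  have "ref_integral p \<noteq> 0"
  proof
    assume "ref_integral p = 0"
    then have "\<forall>t\<in>{-1..1}. poly p t = 0"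
      unfolding ref_integral_def using nn
      by (subst (asm) integral_eq_0_iff) (auto intro!: continuous_intros)
    then have "{-1..1} \<subseteq> {t. poly p t = 0}" by auto
    moreover have "finite {t. poly p t = 0}" using \<open>p \<noteq> 0\<close> by (rule poly_roots_finite)
    ultimately have "finite {-1..1::real}" by (rule finite_subset)
    then show False using infinite_Icc[of "-1" "1::real"] by simp
  qed
  with ge show ?thesis by simp
qed


section \<open>Zeros and orthogonality of the Legendre polynomials\<close>

text \<open>Rolle's theorem between neighbouring zeros; the interval is a parameter so that the
  induction can peel off the largest zero.\<close>

lemma rolle_roots:
  fixes p :: "real poly"
  assumes "finite Z" "card Z = Suc m" "\<And>z. z \<in> Z \<Longrightarrow> poly p z = 0" "Z \<subseteq> {a..b}"
  shows "\<exists>Z'. finite Z' \<and> card Z' = m \<and> Z' \<subseteq> {a<..<b} \<and> (\<forall>z\<in>Z'. poly (pderiv p) z = 0)"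
  using assms
proof (induction m arbitrary: Z b)
  case 0
  then show ?case by (intro exI[of _ "{}"]) auto
next
  case (Suc m)
  define M where "M = Max Z"
  define Z1 where "Z1 = Z - {M}"
  define b1 where "b1 = Max Z1"
  have M: "M \<in> Z" unfolding M_def using Suc.prems by (intro Max_in) auto
  have c1: "card Z1 = Suc m" "finite Z1" using Suc.prems M by (auto simp: Z1_def)
  then have b1: "b1 \<in> Z1" unfolding b1_def by (intro Max_in) auto
  have "b1 < M" using b1 Suc.prems(1) unfolding Z1_def M_def
    by (metis DiffD1 DiffD2 Max_ge insertCI order_le_less)
  have "x \<le> b1" if "x \<in> Z1" for x using c1 that by (simp add: b1_def)
  moreover have "a \<le> x" if "x \<in> Z1" for x using Suc.prems(4) that by (auto simp: Z1_def)
  ultimately have "Z1 \<subseteq> {a..b1}" by (meson atLeastAtMost_iff subsetI)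
  moreover have z1: "poly p z = 0" if "z \<in> Z1" for z
    using that by (intro Suc.prems(3)) (simp add: Z1_def)
  ultimately obtain Z' where Z': "finite Z'" "card Z' = m" "Z' \<subseteq> {a<..<b1}"
      "\<forall>z\<in>Z'. poly (pderiv p) z = 0"
    using Suc.IH[OF c1(2,1)] by blast
  obtain x where x: "b1 < x" "x < M" "poly p M - poly p b1 = (M - b1) * poly (pderiv p) x"
    using poly_MVT[OF \<open>b1 < M\<close>] by blast
  have "poly (pderiv p) x = 0"
    using x(3) Suc.prems(3)[OF M] z1[OF b1] \<open>b1 < M\<close> by simp
  moreover have "a \<le> b1" "M \<le> b" using b1 M Suc.prems(4) by (auto simp: Z1_def)
  moreover have "x \<notin> Z'" using Z'(3) x(1) by auto
  moreover have "insert x Z' \<subseteq> {a<..<b}"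
  proof
    fix y assume "y \<in> insert x Z'"
    then have "y = x \<or> (a < y \<and> y < b1)" using Z'(3) by auto
    then show "y \<in> {a<..<b}" using x(1,2) \<open>a \<le> b1\<close> \<open>M \<le> b\<close> by auto
  qed
  ultimately show ?case
    using Z' by (intro exI[of _ "insert x Z'"]) simp
qed

lemma root_power_dvd_higher_pderiv:
  fixes p :: "real poly"
  assumes "[:-a, 1:] ^ m dvd p"
  shows "[:-a, 1:] ^ (m - j) dvd (pderiv ^^ j) p"
proof (induction j)
  case (Suc j)
  show ?case
  proof (cases "m - j")
    case (Suc r)
    define l where "l = [:-a, 1:]"
    from Suc.IH obtain h where h: "(pderiv ^^ j) p = l ^ Suc r * h"
      unfolding Suc l_def by (elim dvdE)
    have "pderiv l = 1" by (simp add: l_def pderiv_pCons)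
    then have "pderiv (l ^ Suc r * h) = l ^ r * (l * pderiv h + smult (of_nat (Suc r)) h)"
      unfolding pderiv_mult pderiv_power_Suc by (simp add: algebra_simps)
    then have "l ^ r dvd pderiv (l ^ Suc r * h)" by simp
    moreover have "m - Suc j = r" using Suc by simp
    ultimately show ?thesis by (simp add: h l_def)
  qed auto
qed (use assms in simp)

abbreviation rodrigues :: "nat \<Rightarrow> real poly" where
  "rodrigues n \<equiv> [:-1, 0, 1:] ^ n"

text \<open>These are the boundary terms in the integrations by parts, and the two extra zeros in the
  count by Rolle's theorem.\<close>

lemma rodrigues_vanishes:
  assumes "j < n" and "s = 1 \<or> s = (-1::real)"
  shows "poly ((pderiv ^^ j) (rodrigues n)) s = 0"
proof -
  have "[:-s, 1:] ^ n dvd rodrigues n"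
    using assms(2) by (intro dvd_power_same) (auto simp: poly_eq_0_iff_dvd[symmetric])
  from root_power_dvd_higher_pderiv[OF this, of j]
  have "[:-s, 1:] ^ (n - j) dvd (pderiv ^^ j) (rodrigues n)" .
  moreover have "[:-s, 1:] dvd [:-s, 1:] ^ (n - j)" using assms by (intro dvd_power) auto
  ultimately show ?thesis by (auto simp: poly_eq_0_iff_dvd intro: dvd_trans)
qed

lemma legendre_neq_0: "legendre n \<noteq> 0" and degree_legendre: "degree (legendre n) = n"
proof -
  have d: "degree (rodrigues n) = 2 * n" by (simp add: degree_power_eq)
  have dd: "degree ((pderiv ^^ n) (rodrigues n)) = n" by (simp add: degree_higher_pderiv d)
  then show "degree (legendre n) = n" by (simp add: legendre_def)
  show "legendre n \<noteq> 0"
  proof (cases "n = 0")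
    case False
    then show ?thesis using \<open>degree (legendre n) = n\<close> by auto
  qed (simp add: legendre_def)
qed

text \<open>By the Rodrigues formula, \<open>n\<close> integrations by parts move all derivatives to \<open>g\<close>, whose
  \<open>n\<close>-th derivative vanishes.\<close>

lemma legendre_orthogonal:
  assumes "degree g < n"
  shows "ref_integral (legendre n * g) = 0"
proof -
  let ?F = "rodrigues n"
  have "j \<le> n \<Longrightarrow> ref_integral ((pderiv ^^ n) ?F * g)
      = (-1) ^ j * ref_integral ((pderiv ^^ (n - j)) ?F * (pderiv ^^ j) g)" for j
  proof (induction j)
    case (Suc j)
    then have "n - j = Suc (n - Suc j)" by simp
    then have "ref_integral ((pderiv ^^ (n - j)) ?F * (pderiv ^^ j) g)
        = - ref_integral ((pderiv ^^ (n - Suc j)) ?F * (pderiv ^^ Suc j) g)"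
      using Suc.prems by (simp add: ref_integral_by_parts rodrigues_vanishes)
    with Suc show ?case by simp
  qed simp
  from this[of n] have "ref_integral ((pderiv ^^ n) ?F * g) = (-1) ^ n * ref_integral (?F * (pderiv ^^ n) g)"
    by simp
  moreover have "(pderiv ^^ n) g = 0"
    using assms by (intro poly_eqI) (simp add: coeff_higher_pderiv coeff_eq_0)
  ultimately show ?thesis by (simp add: legendre_def ref_integral_smult)
qed

text \<open>Each derivative of \<open>(x\<^sup>2 - 1) ^ n\<close> of order \<open>j < n\<close> has, besides \<open>j\<close> interior zeros, the
  zeros \<open>\<plusminus>1\<close>; by Rolle's theorem the next derivative has one more interior zero.\<close>

lemma legendre_roots_exist:
  "\<exists>Z. finite Z \<and> card Z = n \<and> Z \<subseteq> {-1<..<1} \<and> (\<forall>z\<in>Z. poly (legendre n) z = 0)"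
proof -
  have "j \<le> n \<Longrightarrow> \<exists>Z. finite Z \<and> card Z = j \<and> Z \<subseteq> {-1<..<1} \<and>
      (\<forall>z\<in>Z. poly ((pderiv ^^ j) (rodrigues n)) z = 0)" for j
  proof (induction j)
    case (Suc j)
    then obtain Z where Z: "finite Z" "card Z = j" "Z \<subseteq> {-1<..<1}"
        "\<And>z. z \<in> Z \<Longrightarrow> poly ((pderiv ^^ j) (rodrigues n)) z = 0"
      by auto
    have "card (insert (-1) (insert 1 Z)) = Suc (Suc j)"
      using Z by (subst card_insert_disjoint; force)+
    from rolle_roots[OF _ this, of "(pderiv ^^ j) (rodrigues n)" "-1" 1] show ?case
      using Z Suc.prems by (force simp: rodrigues_vanishes)
  qed (auto intro: exI[of _ "{}"])
  from this[of n] show ?thesis by (auto simp: legendre_def)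
qed

lemma roots_eq_if_card:
  fixes p :: "real poly"
  assumes "p \<noteq> 0" "card Z = degree p" "\<And>z. z \<in> Z \<Longrightarrow> poly p z = 0"
  shows "{s. poly p s = 0} = Z"
proof -
  have f: "finite {s. poly p s = 0}" using assms(1) by (rule poly_roots_finite)
  have "Z \<subseteq> {s. poly p s = 0}" using assms by auto
  moreover have "card {s. poly p s = 0} \<le> card Z" using assms card_poly_roots_bound[of p] by simp
  ultimately show ?thesis using f by (metis card_seteq)
qed

lemma legendre_roots:
  shows "card {s. poly (legendre n) s = 0} = n" "{s. poly (legendre n) s = 0} \<subseteq> {-1<..<1}"
proof -
  obtain Z where Z: "finite Z" "card Z = n" "Z \<subseteq> {-1<..<1}" "\<forall>z\<in>Z. poly (legendre n) z = 0"
    using legendre_roots_exist by blast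
  then have "{s. poly (legendre n) s = 0} = Z"
    by (intro roots_eq_if_card) (auto simp: legendre_neq_0 degree_legendre)
  with Z show "card {s. poly (legendre n) s = 0} = n" "{s. poly (legendre n) s = 0} \<subseteq> {-1<..<1}"
    by auto
qed

lemma pderiv_legendre_neq_0: "n \<ge> 1 \<Longrightarrow> pderiv (legendre n) \<noteq> 0"
  by (simp add: pderiv_eq_0_iff degree_legendre)

lemma pderiv_legendre_roots:
  assumes "n \<ge> 1"
  shows "card {s. poly (pderiv (legendre n)) s = 0} = n - 1"
    "{s. poly (pderiv (legendre n)) s = 0} \<subseteq> {-1<..<1}"
proof -
  let ?Z = "{s. poly (legendre n) s = 0}"
  have "finite ?Z" by (intro poly_roots_finite legendre_neq_0)
  moreover have "card ?Z = Suc (n - 1)" using legendre_roots assms by simp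
  moreover have "?Z \<subseteq> {-1..1}" using legendre_roots(2)[of n] by auto
  ultimately obtain Z where Z: "finite Z" "card Z = n - 1" "Z \<subseteq> {-1<..<1}"
      "\<forall>z\<in>Z. poly (pderiv (legendre n)) z = 0"
    using rolle_roots[of ?Z "n - 1" "legendre n" "-1" 1] by blast
  have "{s. poly (pderiv (legendre n)) s = 0} = Z"
  proof (rule roots_eq_if_card)
    show "card Z = degree (pderiv (legendre n))"
      using Z(2) by (simp add: degree_pderiv degree_legendre)
  qed (use Z(4) pderiv_legendre_neq_0[OF assms] in blast)+
  with Z show "card {s. poly (pderiv (legendre n)) s = 0} = n - 1"
    "{s. poly (pderiv (legendre n)) s = 0} \<subseteq> {-1<..<1}" by auto
qed

text \<open>Parity makes the two end-point weights of the Lobatto rule equal.\<close>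

lemma legendre_parity: "poly (legendre n) (- s) = (-1) ^ n * poly (legendre n) s"
proof -
  have r: "pcompose (rodrigues n) [:0, -1:] = rodrigues n"
    by (simp add: poly_eq_poly_eq_iff[symmetric] fun_eq_iff poly_pcompose)
  have "pcompose ((pderiv ^^ j) p) [:0, -1:] = smult ((-1) ^ j) ((pderiv ^^ j) (pcompose p [:0, -1:]))"
    for j and p :: "real poly"
  proof (induction j)
    case (Suc j)
    have "pderiv (pcompose ((pderiv ^^ j) p) [:0, -1:])
        = pcompose ((pderiv ^^ Suc j) p) [:0, -1:] * [:-1:]"
      by (simp add: pderiv_pcompose pderiv_pCons)
    with Suc have "pcompose ((pderiv ^^ Suc j) p) [:0, -1:]
        = - smult ((-1) ^ j) ((pderiv ^^ Suc j) (pcompose p [:0, -1:]))"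
      by (simp add: pderiv_smult minus_equation_iff eq_commute)
    then show ?case by simp
  qed simp
  from this[of n "rodrigues n"]
  have "poly ((pderiv ^^ n) (rodrigues n)) (- s) = (-1) ^ n * poly ((pderiv ^^ n) (rodrigues n)) s"
    by (simp add: r fun_eq_iff poly_pcompose flip: poly_eq_poly_eq_iff)
  then show ?thesis by (simp add: legendre_def)
qed


section \<open>Interpolatory quadrature\<close>

definition lagrange :: "real set \<Rightarrow> real \<Rightarrow> real poly" where
  "lagrange X x = (\<Prod>y\<in>X - {x}. [:- y / (x - y), 1 / (x - y):])"

lemma poly_lagrange: "poly (lagrange X x) t = (\<Prod>y\<in>X - {x}. (t - y) / (x - y))"
  by (simp add: lagrange_def poly_prod diff_divide_distrib)

lemma degree_lagrange:
  assumes "finite X" "x \<in> X"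
  shows "degree (lagrange X x) < card X"
proof -
  let ?l = "\<lambda>y. [:- y / (x - y), 1 / (x - y):]"
  have "degree (lagrange X x) \<le> (\<Sum>y\<in>X - {x}. degree (?l y))"
    unfolding lagrange_def using degree_prod_sum_le[of "X - {x}" ?l] assms(1)
    by (simp only: comp_def finite_Diff)
  also have "\<dots> \<le> (\<Sum>y\<in>X - {x}. 1)"
    by (intro sum_mono) (simp add: degree_pCons_eq_if)
  also have "\<dots> = card (X - {x})" by simp
  also have "\<dots> < card X" using assms by (intro psubset_card_mono) auto
  finally show ?thesis .
qed

lemma poly_lagrange_node:
  assumes "finite X" "x \<in> X" "y \<in> X"
  shows "poly (lagrange X x) y = (if y = x then 1 else 0)"
proof (cases "y = x")
  case False
  then have "(\<Prod>u\<in>X - {x}. (y - u) / (x - u)) = 0"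
    using assms by (intro prod_zero) auto
  then show ?thesis using False by (simp add: poly_lagrange)
qed (simp add: poly_lagrange)

lemma lagrange_interpolation:
  assumes "finite X" "degree r < card X"
  shows "r = (\<Sum>x\<in>X. smult (poly r x) (lagrange X x))"
proof (rule poly_eqI_degree[of X])
  fix y assume y: "y \<in> X"
  have "poly (\<Sum>x\<in>X. smult (poly r x) (lagrange X x)) y
      = (\<Sum>x\<in>X. if x = y then poly r y else 0)"
    unfolding poly_sum using assms(1) y by (intro sum.cong) (auto simp: poly_lagrange_node)
  then show "poly r y = poly (\<Sum>x\<in>X. smult (poly r x) (lagrange X x)) y"
    using assms(1) y by simp
next
  have "degree (smult (poly r x) (lagrange X x)) \<le> card X - 1" if "x \<in> X" for x
    using degree_lagrange[OF assms(1) that] degree_smult_le[of "poly r x" "lagrange X x"] by simp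
  then have "degree (\<Sum>x\<in>X. smult (poly r x) (lagrange X x)) \<le> card X - 1"
    using assms(1) by (intro degree_sum_le) auto
  then show "degree (\<Sum>x\<in>X. smult (poly r x) (lagrange X x)) < card X"
    using assms(2) by simp
qed (use assms in simp)

abbreviation refweight :: "real set \<Rightarrow> real \<Rightarrow> real" where
  "refweight X x \<equiv> qweight X (-1) 1 x"

lemma refweight_lagrange: "refweight X x = ref_integral (lagrange X x) / 2"
  by (simp add: qweight_def ref_integral_def poly_lagrange[abs_def])

text \<open>Division by the node polynomial \<open>q\<close> leaves a remainder, which is integrated exactly by
  interpolation; the multiple of \<open>q\<close> vanishes at the nodes, and its integral vanishes by
  orthogonality. The number \<open>m\<close> counts the degrees gained: \<open>n\<close> for Gauss, \<open>n - 2\<close> for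
  Lobatto.\<close>

lemma quadrature_exact:
  assumes X: "finite X" "degree q = card X" "q \<noteq> 0" "\<And>x. x \<in> X \<Longrightarrow> poly q x = 0"
    and orth: "\<And>g. degree g < m \<Longrightarrow> ref_integral (q * g) = 0"
    and p: "degree p < card X + m" and ne: "X \<noteq> {}"
  shows "(\<Sum>x\<in>X. refweight X x * poly p x) = ref_integral p / 2"
proof -
  define g where "g = p div q"
  define r where "r = p mod q"
  have pr: "p = q * g + r" by (simp add: g_def r_def)
  have cX: "card X > 0" using X(1) ne by (simp add: card_gt_0_iff)
  have r: "degree r < card X"
    using degree_mod_less[OF X(3), of p] X(2) cX by (auto simp: r_def)
  have "ref_integral (q * g) = 0"
  proof (cases "g = 0")
    case False
    have "degree (q * g) = card X + degree g" using False X by (simp add: degree_mult_eq)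
    moreover have "q * g = p - r" by (simp add: pr)
    then have "degree (q * g) \<le> max (degree p) (degree r)" by (simp add: degree_diff_le_max)
    ultimately have "degree g < m" using p r by linarith
    then show ?thesis by (rule orth)
  qed simp
  then have "ref_integral p = ref_integral r" by (simp add: pr ref_integral_add)
  also have "\<dots> = ref_integral (\<Sum>x\<in>X. smult (poly r x) (lagrange X x))"
    using lagrange_interpolation[OF X(1) r] by simp
  also have "\<dots> = (\<Sum>x\<in>X. poly r x * ref_integral (lagrange X x))"
    by (simp add: ref_integral_sum ref_integral_smult)
  also have "\<dots> = (\<Sum>x\<in>X. poly p x * ref_integral (lagrange X x))"
    by (intro sum.cong refl) (simp add: pr X)
  finally show ?thesis
    by (simp add: refweight_lagrange sum_divide_distrib mult.commute)
qed

text \<open>Exactness for a nonnegative polynomial that vanishes at all other nodes determines the sign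
  of the weight.\<close>

lemma weight_pos:
  assumes "finite X" "x \<in> X"
    and exact: "(\<Sum>x\<in>X. refweight X x * poly p x) = ref_integral p / 2"
    and p: "\<And>t. -1 \<le> t \<Longrightarrow> t \<le> 1 \<Longrightarrow> poly p t \<ge> 0"
      "\<And>y. y \<in> X \<Longrightarrow> y \<noteq> x \<Longrightarrow> poly p y = 0" "poly p x > 0"
  shows "refweight X x > 0"
proof -
  have "p \<noteq> 0" using p(3) by auto
  then have "0 < ref_integral p / 2" using p(1) ref_integral_pos by simp
  also have "\<dots> = (\<Sum>y\<in>X. if y = x then refweight X x * poly p x else 0)"
    unfolding exact[symmetric] using p(2) by (intro sum.cong) auto
  also have "\<dots> = refweight X x * poly p x" using assms(1,2) by simp
  finally show ?thesis using p(3) by (simp add: zero_less_mult_iff)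
qed

abbreviation lg_ref :: "nat \<Rightarrow> real set" where
  "lg_ref n \<equiv> {s. poly (legendre n) s = 0}"

lemma lg_ref_finite: "finite (lg_ref n)"
  by (intro poly_roots_finite legendre_neq_0)

lemma lg_exact:
  assumes "n \<ge> 1" "degree p < 2 * n"
  shows "(\<Sum>x\<in>lg_ref n. refweight (lg_ref n) x * poly p x) = ref_integral p / 2"
  by (rule quadrature_exact[where q = "legendre n" and m = n])
     (use assms legendre_roots[of n] in \<open>auto simp: lg_ref_finite legendre_orthogonal degree_legendre
        legendre_neq_0 dest: arg_cong[of _ _ card]\<close>)

lemma degree_prod_squares: "finite Y \<Longrightarrow> degree ((\<Prod>y\<in>Y. [:-y, 1:])\<^sup>2 :: real poly) = 2 * card Y"
  by (simp add: degree_power_eq degree_prod_eq_sum_degree)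

text \<open>The test polynomial is the squared node polynomial of the other nodes.\<close>

lemma lg_weight_pos:
  assumes "x \<in> lg_ref n"
  shows "refweight (lg_ref n) x > 0"
proof -
  let ?X = "lg_ref n"
  let ?p = "(\<Prod>y\<in>?X - {x}. [:-y, 1:])\<^sup>2"
  have n: "n \<ge> 1" using assms legendre_roots(1)[of n] by (cases n) (auto simp: lg_ref_finite)
  show ?thesis
  proof (rule weight_pos[of _ _ ?p])
    have "degree ?p < 2 * n"
      using assms n legendre_roots(1)[of n] by (simp add: degree_prod_squares lg_ref_finite)
    then show "(\<Sum>x\<in>?X. refweight ?X x * poly ?p x) = ref_integral ?p / 2" using n by (rule lg_exact[rotated])
  qed (use assms in \<open>auto simp: poly_prod lg_ref_finite\<close>)
qed

definition lgl_interior :: "nat \<Rightarrow> real set" where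
  "lgl_interior n = {s. poly (pderiv (legendre (n - 1))) s = 0}"

definition lgl_ref :: "nat \<Rightarrow> real set" where
  "lgl_ref n = {-1, 1} \<union> lgl_interior n"

lemma lgl_ref_finite:
  assumes "n \<ge> 2"
  shows "finite (lgl_interior n)" "finite (lgl_ref n)"
  using poly_roots_finite[OF pderiv_legendre_neq_0, of "n - 1"] assms by (auto simp: lgl_ref_def lgl_interior_def)

lemma lgl_interior:
  assumes "n \<ge> 2"
  shows "card (lgl_interior n) = n - 2" "lgl_interior n \<subseteq> {-1<..<1}" "card (lgl_ref n) = n"
proof -
  show i: "card (lgl_interior n) = n - 2" "lgl_interior n \<subseteq> {-1<..<1}"
    using pderiv_legendre_roots[of "n - 1"] assms by (simp_all add: lgl_interior_def)
  have "-1 \<notin> lgl_interior n" "1 \<notin> lgl_interior n" using i(2) by auto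
  then have "card (lgl_ref n) = Suc (Suc (card (lgl_interior n)))"
    using lgl_ref_finite[OF assms] by (simp add: lgl_ref_def)
  then show "card (lgl_ref n) = n" using i assms by simp
qed

text \<open>The node polynomial \<open>(x\<^sup>2 - 1) P'\<close> is orthogonal to degrees below \<open>n - 2\<close>: integration by
  parts, in which the factor \<open>x\<^sup>2 - 1\<close> kills the boundary terms, reduces this to the
  orthogonality of the Legendre polynomial \<open>P\<close> of degree \<open>n - 1\<close>.\<close>

lemma lgl_exact:
  assumes "n \<ge> 2" "degree p + 3 \<le> 2 * n"
  shows "(\<Sum>x\<in>lgl_ref n. refweight (lgl_ref n) x * poly p x) = ref_integral p / 2"
proof (rule quadrature_exact[where q = "[:-1, 0, 1:] * pderiv (legendre (n - 1))" and m = "n - 2"])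
  let ?P = "legendre (n - 1)"
  have nz: "pderiv ?P \<noteq> 0" using assms by (intro pderiv_legendre_neq_0) simp
  then show "[:-1, 0, 1:] * pderiv ?P \<noteq> 0"
    by (simp only: mult_eq_0_iff pCons_eq_0_iff) simp
  have "degree ([:-1, 0, 1:] * pderiv ?P) = 2 + (n - 2)"
    using nz by (subst degree_mult_eq) (auto simp: degree_pderiv degree_legendre)
  then show "degree ([:-1, 0, 1:] * pderiv ?P) = card (lgl_ref n)"
    using lgl_interior[OF assms(1)] assms(1) by simp
  show "degree p < card (lgl_ref n) + (n - 2)"
    unfolding lgl_interior(3)[OF assms(1)] using assms by simp
  fix g :: "real poly" assume g: "degree g < n - 2"
  let ?h = "[:-1, 0, 1:] * g"
  have "degree ?h \<le> 2 + degree g" by (rule order_trans[OF degree_mult_le]) simp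
  then have "degree (pderiv ?h) < n - 1" using g by (simp only: degree_pderiv)
  then have "ref_integral (?P * pderiv ?h) = 0" by (rule legendre_orthogonal)
  then have "ref_integral (pderiv ?P * ?h) = 0" by (subst ref_integral_by_parts) simp
  then show "ref_integral ([:-1, 0, 1:] * pderiv ?P * g) = 0" by (simp only: ac_simps)
qed (use lgl_ref_finite[OF assms(1)] in \<open>auto simp: lgl_ref_def lgl_interior_def\<close>)

text \<open>The exactness degree \<open>2 n - 3\<close> leaves room for the squared node polynomial of the other
  interior nodes times one factor \<open>1 + x\<close> or \<open>1 - x\<close> for each end point that is not the node
  itself.\<close>

lemma lgl_weight_pos:
  assumes n: "n \<ge> 2" and x: "x \<in> lgl_ref n"
  shows "refweight (lgl_ref n) x > 0"
proof -
  let ?X = "lgl_ref n" and ?Y = "lgl_interior n"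
  note fin = lgl_ref_finite[OF n] and int = lgl_interior[OF n]
  have pos: "refweight ?X x > 0"
    if Y: "finite Y" "x \<notin> Y" and deg: "degree a + 2 * card Y + 3 \<le> 2 * n"
      and a: "\<And>t. -1 \<le> t \<Longrightarrow> t \<le> 1 \<Longrightarrow> poly a t \<ge> 0" "poly a x > 0"
        "\<And>y. y \<in> ?X \<Longrightarrow> y \<notin> Y \<Longrightarrow> y \<noteq> x \<Longrightarrow> poly a y = 0"
    for a Y
  proof -
    let ?p = "a * (\<Prod>y\<in>Y. [:-y, 1:])\<^sup>2"
    have p: "poly ?p t = poly a t * (\<Prod>y\<in>Y. t - y)\<^sup>2" for t
      by (simp add: poly_prod)
    have "degree ?p \<le> degree a + 2 * card Y"
      by (rule order_trans[OF degree_mult_le]) (simp add: degree_prod_squares Y(1))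
    then have "degree ?p + 3 \<le> 2 * n" using deg by simp
    from lgl_exact[OF n this] show ?thesis
    proof (rule weight_pos[OF fin(2) x])
      show "poly ?p y = 0" if "y \<in> ?X" "y \<noteq> x" for y
      proof (cases "y \<in> Y")
        case True
        then have "(\<Prod>u\<in>Y. y - u) = 0" using Y(1) by auto
        then show ?thesis unfolding p by simp
      next
        case False
        then show ?thesis unfolding p using a(3)[OF that(1) _ that(2)] by simp
      qed
      have "(\<Prod>y\<in>Y. x - y) \<noteq> 0" using Y by auto
      then show "poly ?p x > 0" unfolding p using a(2) by (intro mult_pos_pos) auto
    qed (simp add: p a(1))
  qed
  consider "x = 1" | "x = -1" | "x \<in> ?Y" using x by (auto simp: lgl_ref_def)
  then show ?thesis
  proof cases
    case 1
    show ?thesis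
      by (rule pos[of ?Y "[:1, 1:]"]) (use int fin n 1 in \<open>auto simp: lgl_ref_def\<close>)
  next
    case 2
    show ?thesis
      by (rule pos[of ?Y "[:1, -1:]"]) (use int fin n 2 in \<open>auto simp: lgl_ref_def\<close>)
  next
    case 3
    have c: "card (?Y - {x}) = n - 3" using 3 int fin by simp
    have n3: "n \<ge> 3" using 3 int fin n by (cases "n = 2") auto
    have sq: "t\<^sup>2 \<le> 1" if "-1 \<le> t" "t \<le> 1" for t :: real
      using that by (simp add: abs_square_le_1 abs_le_iff)
    have "\<bar>x\<bar> < 1" using 3 int(2) by (auto simp: abs_less_iff)
    then have "x\<^sup>2 < 1" by (simp add: abs_square_less_1)
    then show ?thesis
      using sq c n3 fin 3
      by (intro pos[of "?Y - {x}" "[:1, 0, -1:]"]) (auto simp: lgl_ref_def power2_eq_square)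
  qed
qed

lemma lgl_end_weight_ref: "lgl_end_weight n = refweight (lgl_ref n) 1"
  by (simp add: lgl_end_weight_def lgl_nodes_def lgl_ref_def lgl_interior_def)

lemma lgl_end_weight_pos: "n \<ge> 2 \<Longrightarrow> lgl_end_weight n > 0"
  unfolding lgl_end_weight_ref by (rule lgl_weight_pos) (auto simp: lgl_ref_def)

lemma pderiv_legendre_parity:
  "poly (pderiv (legendre n)) (- s) = (-1) ^ Suc n * poly (pderiv (legendre n)) s"
proof -
  have "pcompose (legendre n) [:0, -1:] = smult ((-1) ^ n) (legendre n)"
    by (simp add: fun_eq_iff poly_pcompose legendre_parity flip: poly_eq_poly_eq_iff)
  then have "pderiv (pcompose (legendre n) [:0, -1:]) = smult ((-1) ^ n) (pderiv (legendre n))"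
    by (simp add: pderiv_smult)
  then have "- poly (pderiv (legendre n)) (- s) = (-1) ^ n * poly (pderiv (legendre n)) s"
    by (simp add: pderiv_pcompose pderiv_pCons fun_eq_iff poly_pcompose flip: poly_eq_poly_eq_iff)
  then show ?thesis by (simp add: minus_equation_iff eq_commute)
qed

text \<open>Testing with \<open>P' (1 \<plusminus> x)\<close>, which vanishes at all nodes but one end point, expresses both
  end-point weights by the values of \<open>P\<close> and \<open>P'\<close> at \<open>\<plusminus>1\<close>.\<close>

lemma lgl_end_weight_left:
  assumes n: "n \<ge> 2"
  shows "refweight (lgl_ref n) (-1) = lgl_end_weight n"
proof -
  let ?P = "legendre (n - 1)" and ?X = "lgl_ref n"
  note fin = lgl_ref_finite[OF n]
  have P0: "ref_integral ?P = 0" using legendre_orthogonal[of 1 "n - 1"] n by simp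
  have one: "poly (pderiv ?P) 1 \<noteq> 0" using lgl_interior(2)[OF n] by (auto simp: lgl_interior_def)
  have deg: "degree (pderiv ?P * [:1, c:]) + 3 \<le> 2 * n" for c
  proof -
    have "degree (pderiv ?P * [:1, c:]) \<le> degree (pderiv ?P) + degree [:1, c:]"
      by (rule degree_mult_le)
    moreover have "degree [:1, c:] \<le> 1" by simp
    ultimately have "degree (pderiv ?P * [:1, c:]) \<le> n - 2 + 1"
      unfolding degree_pderiv degree_legendre by linarith
    then show ?thesis using n by linarith
  qed
  have sum2: "(\<Sum>x\<in>?X. f x) = f s" if "s = 1 \<or> s = -1" "f (- s) = 0" "\<And>x. x \<in> lgl_interior n \<Longrightarrow> f x = 0"
    for f :: "real \<Rightarrow> real" and s
  proof -
    have "(\<Sum>x\<in>?X. f x) = (\<Sum>x\<in>?X. if x = s then f s else 0)"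
      using that by (intro sum.cong) (auto simp: lgl_ref_def)
    also have "\<dots> = f s" using that(1) fin by (auto simp: lgl_ref_def)
    finally show ?thesis .
  qed
  have "refweight ?X 1 * (poly (pderiv ?P) 1 * 2)
      = (\<Sum>x\<in>?X. refweight ?X x * poly (pderiv ?P * [:1, 1:]) x)"
    by (subst sum2[of 1]) (auto simp: lgl_interior_def algebra_simps)
  also have "\<dots> = poly ?P 1"
    using P0 by (subst lgl_exact[OF n deg], subst ref_integral_by_parts) (simp add: pderiv_pCons)
  finally have r: "refweight ?X 1 * (poly (pderiv ?P) 1 * 2) = poly ?P 1" .
  have "refweight ?X (-1) * (poly (pderiv ?P) (-1) * 2)
      = (\<Sum>x\<in>?X. refweight ?X x * poly (pderiv ?P * [:1, -1:]) x)"
    by (subst sum2[of "-1"]) (auto simp: lgl_interior_def algebra_simps)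
  also have "\<dots> = - poly ?P (-1)"
    using P0 ref_integral_smult[of "-1" ?P]
    by (subst lgl_exact[OF n deg], subst ref_integral_by_parts) (simp add: pderiv_pCons)
  finally have l: "refweight ?X (-1) * (poly (pderiv ?P) (-1) * 2) = - poly ?P (-1)" .
  have "(-1) ^ n * (refweight ?X (-1) * (poly (pderiv ?P) 1 * 2)) = (-1) ^ n * poly ?P 1"
    using l n legendre_parity[of "n - 1" 1] pderiv_legendre_parity[of "n - 1" 1]
    by (cases n) (simp_all add: algebra_simps)
  then have "refweight ?X (-1) * (poly (pderiv ?P) 1 * 2) = refweight ?X 1 * (poly (pderiv ?P) 1 * 2)"
    using r by simp
  then show ?thesis using one by (simp add: lgl_end_weight_ref)
qed

lemma lgl_sum_ge_ends:
  assumes n: "n \<ge> 2" and nn: "\<And>x. x \<in> lgl_ref n \<Longrightarrow> f x \<ge> 0"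
  shows "(\<Sum>x\<in>lgl_ref n. refweight (lgl_ref n) x * f x) \<ge> lgl_end_weight n * (f (-1) + f 1)"
proof -
  have "lgl_end_weight n * (f (-1) + f 1) = (\<Sum>x\<in>{-1, 1}. refweight (lgl_ref n) x * f x)"
    using lgl_end_weight_left[OF n] by (simp add: lgl_end_weight_ref algebra_simps)
  also have "\<dots> \<le> (\<Sum>x\<in>lgl_ref n. refweight (lgl_ref n) x * f x)"
  proof (intro sum_mono2)
    fix x assume "x \<in> lgl_ref n - {-1, 1}"
    then show "0 \<le> refweight (lgl_ref n) x * f x"
      using lgl_weight_pos[OF n] nn by (intro mult_nonneg_nonneg) (auto intro: less_imp_le)
  qed (use lgl_ref_finite[OF n] in \<open>auto simp: lgl_ref_def\<close>)
  finally show ?thesis .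
qed

text \<open>The rule integrates \<open>x\<^sup>2\<close> exactly to the mean \<open>1 / 3\<close>, of which the two end points
  contribute twice their weight.\<close>

lemma lgl_end_weight_le:
  assumes "n \<ge> 3"
  shows "lgl_end_weight n \<le> 1 / 6"
proof -
  have n: "n \<ge> 2" using assms by simp
  have "ref_integral [:0, 0, 1:] = 2 / 3"
    using ref_integral_pderiv[of "[:0, 0, 0, 1 / 3:]"] by (simp add: pderiv_pCons)
  then have "(\<Sum>x\<in>lgl_ref n. refweight (lgl_ref n) x * x\<^sup>2) = 1 / 3"
    using lgl_exact[OF n, of "[:0, 0, 1:]"] assms by (simp add: power2_eq_square)
  with lgl_sum_ge_ends[OF n, of "\<lambda>x. x\<^sup>2"] show ?thesis by simp
qed


section \<open>Transport to an arbitrary interval\<close>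

definition aff :: "real \<Rightarrow> real \<Rightarrow> real \<Rightarrow> real" where
  "aff a b s = (a + b) / 2 + (b - a) / 2 * s"

lemma inj_aff: "a < b \<Longrightarrow> inj (aff a b)"
  by (auto simp: inj_def aff_def)

text \<open>Quadrature weights are normalised by the length of the interval and therefore invariant
  under affine maps.\<close>

lemma qweight_aff:
  assumes ab: "a < b"
  shows "qweight (aff a b ` X) a b (aff a b x) = refweight X x"
proof -
  define f where "f = poly (lagrange (aff a b ` X) (aff a b x))"
  define m where "m = (b - a) / 2"
  define c where "c = (a + b) / 2"
  have m: "m > 0" using ab by (simp add: m_def)
  have aff: "aff a b = (\<lambda>s. m * s + c)" by (simp add: fun_eq_iff aff_def m_def c_def)
  have "(f has_integral integral {a..b} f) (cbox a b)"
    using poly_integrable by (auto simp: f_def cbox_interval integrable_integral)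
  then have "((\<lambda>s. f (m *\<^sub>R s + c)) has_integral (integral {a..b} f /\<^sub>R m ^ DIM(real)))
      (cbox ((a - c) /\<^sub>R m) ((b - c) /\<^sub>R m))"
    using m by (rule has_integral_affinity')
  moreover have "(a - c) /\<^sub>R m = -1" "(b - c) /\<^sub>R m = 1"
    using ab by (simp_all add: m_def c_def field_simps)
  ultimately have int: "((\<lambda>s. f (aff a b s)) has_integral (integral {a..b} f / m)) {-1..1}"
    by (simp add: aff divide_inverse mult.commute cbox_interval)
  have "f (aff a b s) = poly (lagrange X x) s" for s
  proof -
    have "aff a b ` X - {aff a b x} = aff a b ` (X - {x})"
      using inj_aff[OF ab] by (auto simp: inj_def)
    then have "f (aff a b s)
        = (\<Prod>y\<in>X - {x}. (aff a b s - aff a b y) / (aff a b x - aff a b y))"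
      unfolding f_def poly_lagrange
      by (simp add: prod.reindex inj_on_subset[OF inj_aff[OF ab]])
    also have "\<dots> = (\<Prod>y\<in>X - {x}. (s - y) / (x - y))"
    proof (rule prod.cong[OF refl])
      fix y
      have "aff a b u - aff a b y = m * (u - y)" for u by (simp add: aff algebra_simps)
      then show "(aff a b s - aff a b y) / (aff a b x - aff a b y) = (s - y) / (x - y)"
        using m by simp
    qed
    finally show ?thesis by (simp add: poly_lagrange)
  qed
  with int have "ref_integral (lagrange X x) = integral {a..b} f / m"
    by (simp add: ref_integral_def integral_unique)
  moreover have "qweight (aff a b ` X) a b (aff a b x) = integral {a..b} f / (b - a)"
    by (simp add: qweight_def f_def poly_lagrange[abs_def])
  moreover have "b - a = m * 2" by (simp add: m_def)
  then have "integral {a..b} f / m / 2 = integral {a..b} f / (b - a)" by simp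
  ultimately show ?thesis
    by (simp only: refweight_lagrange)
qed

lemma sum_qweight_aff:
  assumes "a < b"
  shows "(\<Sum>x\<in>aff a b ` X. qweight (aff a b ` X) a b x * f x)
      = (\<Sum>s\<in>X. refweight X s * f (aff a b s))"
  using inj_on_subset[OF inj_aff[OF assms]]
  by (simp add: sum.reindex qweight_aff[OF assms])

lemma lg_nodes_aff: "lg_nodes n a b = aff a b ` lg_ref n"
  and lgl_nodes_aff: "lgl_nodes n a b = aff a b ` lgl_ref n"
  by (simp_all add: lg_nodes_def lgl_nodes_def aff_def lgl_ref_def lgl_interior_def)

lemma lgl_nodes_ends: "a \<in> lgl_nodes n a b" "b \<in> lgl_nodes n a b"
proof -
  have "aff a b (-1) = a" "aff a b 1 = b" by (simp_all add: aff_def field_simps)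
  moreover have "-1 \<in> lgl_ref n" "1 \<in> lgl_ref n" by (simp_all add: lgl_ref_def)
  ultimately show "a \<in> lgl_nodes n a b" "b \<in> lgl_nodes n a b"
    unfolding lgl_nodes_aff by (metis imageI)+
qed

lemma lg_nodes_finite: "finite (lg_nodes n a b)"
  by (simp add: lg_nodes_aff lg_ref_finite)

lemma lgl_nodes_finite: "n \<ge> 2 \<Longrightarrow> finite (lgl_nodes n a b)"
  unfolding lgl_nodes_aff by (intro finite_imageI lgl_ref_finite)

lemma lg_nodes_nonempty: "n \<ge> 1 \<Longrightarrow> lg_nodes n a b \<noteq> {}"
  using legendre_roots(1)[of n] by (metis (no_types, lifting) card.empty image_is_empty lg_nodes_aff not_one_le_zero)

lemma lg_nodes_interior: "a < b \<Longrightarrow> x \<in> lg_nodes n a b \<Longrightarrow> a < x \<and> x < b"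
proof -
  assume ab: "a < b" and "x \<in> lg_nodes n a b"
  then obtain s where s: "s \<in> lg_ref n" "x = aff a b s" by (auto simp: lg_nodes_aff)
  then have "-1 < s" "s < 1" using legendre_roots(2)[of n] by auto
  then have "(b - a) / 2 * (-1) < (b - a) / 2 * s" "(b - a) / 2 * s < (b - a) / 2 * 1"
    using ab by (intro mult_strict_left_mono; simp)+
  then show ?thesis by (simp add: s aff_def field_simps)
qed

lemma lg_qweight_pos:
  assumes "a < b" "x \<in> lg_nodes n a b"
  shows "qweight (lg_nodes n a b) a b x > 0"
  using assms by (auto simp: lg_nodes_aff qweight_aff lg_weight_pos)

text \<open>Since the weights sum to 1, this is a mean value; factors for the lengths of intervals
  appear only in the tensor-product rules.\<close>

definition lg_average :: "nat \<Rightarrow> real \<Rightarrow> real \<Rightarrow> (real \<Rightarrow> real) \<Rightarrow> real" where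
  "lg_average k a b f = (\<Sum>x\<in>lg_nodes (k + 1) a b. qweight (lg_nodes (k + 1) a b) a b x * f x)"

lemma lg_average_exact:
  assumes "a < b" "degree p \<le> 2 * k + 1"
  shows "lg_average k a b (poly p) = ref_integral (pcompose p [:(a + b) / 2, (b - a) / 2:]) / 2"
proof -
  have "degree (pcompose p [:(a + b) / 2, (b - a) / 2:]) < 2 * (k + 1)"
    using assms degree_pcompose_le[of p "[:(a + b) / 2, (b - a) / 2:]"] by simp
  from lg_exact[OF _ this] show ?thesis
    unfolding lg_average_def lg_nodes_aff sum_qweight_aff[OF assms(1)]
    by (simp add: poly_pcompose aff_def mult.commute)
qed

text \<open>Both rules are exact for \<open>p\<close>, so the Gauss mean equals the Lobatto mean, in which all terms
  are nonnegative and those at the end points can be singled out.\<close>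

lemma lg_average_ge_ends:
  assumes ab: "a < b" and n: "n \<ge> 2" and deg: "degree p \<le> 2 * k + 1" "degree p + 3 \<le> 2 * n"
    and nn: "\<And>x. x \<in> lgl_nodes n a b \<Longrightarrow> poly p x \<ge> 0"
  shows "lg_average k a b (poly p) \<ge> lgl_end_weight n * (poly p a + poly p b)"
proof -
  let ?q = "pcompose p [:(a + b) / 2, (b - a) / 2:]"
  have dq: "degree ?q + 3 \<le> 2 * n"
    using deg(2) ab by (simp add: degree_pcompose)
  have q: "poly ?q s = poly p (aff a b s)" for s by (simp add: poly_pcompose aff_def mult.commute)
  have "lgl_end_weight n * (poly ?q (-1) + poly ?q 1)
      \<le> (\<Sum>x\<in>lgl_ref n. refweight (lgl_ref n) x * poly ?q x)"
    using nn by (intro lgl_sum_ge_ends[OF n]) (simp add: q lgl_nodes_aff)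
  moreover have "\<dots> = lg_average k a b (poly p)"
    using lgl_exact[OF n dq] lg_average_exact[OF ab deg(1)] by simp
  moreover have "aff a b (-1) = a" "aff a b 1 = b" by (simp_all add: aff_def field_simps)
  ultimately show ?thesis by (simp only: q)
qed

text \<open>The weight \<open>x\<^sup>2\<close> of the energy variable raises the degree to \<open>k + 2\<close>. The Lobatto rule is
  exact for this degree, the Gauss rule with \<open>k + 1\<close> nodes only if \<open>k \<ge> 1\<close>. For \<open>k = 0\<close> the
  Gauss mean of \<open>x\<^sup>2\<close> is smaller than the exact mean, but the bound \<open>1 / 6\<close> for the
  end-point weight leaves enough room.\<close>

lemma lg_average_energy_ge_ends:
  assumes ab: "0 \<le> a" "a < b" and n: "2 * n \<ge> k + 5" and deg: "degree p \<le> k"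
    and nn: "\<And>x. x \<in> lgl_nodes n a b \<Longrightarrow> poly p x \<ge> 0"
  shows "lg_average k a b (\<lambda>x. x\<^sup>2 * poly p x) \<ge> lgl_end_weight n * (a\<^sup>2 * poly p a + b\<^sup>2 * poly p b)"
proof (cases "k = 0")
  case False
  let ?q = "[:0, 0, 1:] * p"
  have q: "poly ?q x = x\<^sup>2 * poly p x" for x by (simp add: power2_eq_square)
  have "degree ?q \<le> k + 2"
    by (rule order_trans[OF degree_mult_le]) (use deg in simp)
  then have "lg_average k a b (poly ?q) \<ge> lgl_end_weight n * (poly ?q a + poly ?q b)"
    using False n ab nn
    by (intro lg_average_ge_ends) (auto simp: q zero_le_mult_iff simp del: mult_pCons_left)
  moreover have "poly ?q = (\<lambda>x. x\<^sup>2 * poly p x)" using q by blast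
  ultimately show ?thesis by (simp only:)
next
  case True
  then obtain c where p: "p = [:c:]" using deg by (metis degree_eq_zeroE le_zero_eq)
  have c: "c \<ge> 0" using nn[OF lgl_nodes_ends(1)] by (simp add: p)
  define m where "m = (a + b) / 2"
  let ?X = "lg_nodes (k + 1) a b"
  let ?w = "qweight ?X a b"
  have lin: "(\<Sum>x\<in>?X. ?w x * (x - m)) = 0"
  proof -
    have "pcompose [:- m, 1:] [:(a + b) / 2, (b - a) / 2:] = pderiv [:0, 0, (b - a) / 4:]"
      by (simp add: pcompose_pCons pderiv_pCons m_def)
    then have "ref_integral (pcompose [:- m, 1:] [:(a + b) / 2, (b - a) / 2:]) = 0"
      unfolding \<open>pcompose _ _ = _\<close> ref_integral_pderiv by simp
    then have "lg_average k a b (poly [:- m, 1:]) = 0"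
      by (subst lg_average_exact[OF ab(2)]) simp_all
    then show ?thesis by (simp add: lg_average_def)
  qed
  have one: "(\<Sum>x\<in>?X. ?w x) = 1"
  proof -
    have "ref_integral 1 = 2" using ref_integral_pderiv[of "[:0, 1:]"] by (simp add: pderiv_pCons pCons_one)
    then have "lg_average k a b (poly 1) = 1"
      by (subst lg_average_exact[OF ab(2)]) (simp_all add: pcompose_1)
    then show ?thesis by (simp add: lg_average_def)
  qed
  \<comment> \<open>Exactness in degree 1 identifies the midpoint \<open>m\<close> as the mean; the variance is nonnegative.\<close>
  have "lg_average k a b (\<lambda>x. x\<^sup>2) = (\<Sum>x\<in>?X. ?w x * (x - m)\<^sup>2) + 2 * m * (\<Sum>x\<in>?X. ?w x * (x - m))
      + m\<^sup>2 * (\<Sum>x\<in>?X. ?w x)"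
    unfolding lg_average_def sum_distrib_left sum.distrib[symmetric]
    by (intro sum.cong refl) (simp add: power2_eq_square algebra_simps)
  moreover have "(\<Sum>x\<in>?X. ?w x * (x - m)\<^sup>2) \<ge> 0"
    using lg_qweight_pos[OF ab(2)] by (intro sum_nonneg mult_nonneg_nonneg) (auto intro: less_imp_le)
  ultimately have "lg_average k a b (\<lambda>x. x\<^sup>2) \<ge> m\<^sup>2" unfolding lin one by simp
  moreover have "lgl_end_weight n * (a\<^sup>2 + b\<^sup>2) \<le> 1 / 6 * (a\<^sup>2 + b\<^sup>2)"
    using n by (intro mult_right_mono lgl_end_weight_le) auto
  moreover have "1 / 6 * (a\<^sup>2 + b\<^sup>2) \<le> m\<^sup>2"
  proof -
    have "m\<^sup>2 - 1 / 6 * (a\<^sup>2 + b\<^sup>2) = (a\<^sup>2 + b\<^sup>2) / 12 + a * b / 2"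
      by (simp add: m_def power2_eq_square field_simps)
    moreover have "\<dots> \<ge> 0" using ab by simp
    ultimately show ?thesis by linarith
  qed
  ultimately have "lgl_end_weight n * (a\<^sup>2 + b\<^sup>2) * c \<le> lg_average k a b (\<lambda>x. x\<^sup>2) * c"
    using c by (intro mult_right_mono) auto
  moreover have "lg_average k a b (\<lambda>x. x\<^sup>2 * c) = lg_average k a b (\<lambda>x. x\<^sup>2) * c"
    by (simp add: lg_average_def sum_distrib_right mult.assoc)
  ultimately show ?thesis by (simp add: p algebra_simps)
qed


section \<open>Moments of nonnegative distributions\<close>

lemma closed_cone: "closed {M. gam M \<ge> 0}"
  unfolding gam_def by (intro closed_Collect_le continuous_intros)

lemma cone_fst_nonneg: "gam M \<ge> 0 \<Longrightarrow> fst M \<ge> 0"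
  using norm_ge_zero[of "snd M"] unfolding gam_def by linarith

lemma realizable_cone: "M \<in> realizable \<Longrightarrow> gam M \<ge> 0"
  by (simp add: realizable_def)

text \<open>The claim is the integral of the hypothesis against the distribution that realizes the
  moments. At the vertex of the cone all terms vanish, because the tensor \<open>Kten\<close> carries the
  factor \<open>fst M\<close>.\<close>

lemma closure_positivity:
  assumes ex: "exact_closure cl" and M: "gam M \<ge> 0"
    and pos: "\<And>l :: vec3. norm l = 1 \<Longrightarrow>
      c + b \<bullet> l + (\<Sum>i\<in>UNIV. \<Sum>j\<in>UNIV. B $ i $ j * (l $ i * l $ j)) \<ge> 0"
  shows "c * fst M + b \<bullet> snd M + (\<Sum>i\<in>UNIV. \<Sum>j\<in>UNIV. B $ i $ j * Kten cl M $ i $ j) \<ge> 0"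
proof (cases "fst M = 0")
  case True
  then have "snd M = 0" using M by (simp add: gam_def)
  with True show ?thesis by (simp add: Kten_def)
next
  case False
  then have "M \<in> realizable" using M cone_fst_nonneg[OF M] by (simp add: realizable_def)
  then obtain \<mu> :: "vec3 measure" where
      sets: "sets \<mu> = sets (restrict_space borel (sphere 0 1))" and fin: "finite_measure \<mu>" and
      D: "fst M = 1 / (4 * pi) * (LINT l|\<mu>. 1)" and
      I: "\<And>i. snd M $ i = 1 / (4 * pi) * (LINT l|\<mu>. l $ i)" and
      K: "\<And>i j. Kten cl M $ i $ j = 1 / (4 * pi) * (LINT l|\<mu>. l $ i * l $ j)"
    using ex unfolding exact_closure_def by blast
  interpret finite_measure \<mu> by (rule fin)
  have space: "space \<mu> = sphere 0 1"
    using sets_eq_imp_space_eq[OF sets] by (simp add: space_restrict_space)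
  have meas: "f \<in> borel_measurable \<mu>" if "continuous_on UNIV f" for f :: "vec3 \<Rightarrow> real"
  proof -
    have "f \<in> borel_measurable (restrict_space borel (sphere 0 1))"
      using that by (intro measurable_restrict_space1 borel_measurable_continuous_onI)
    then show ?thesis using measurable_cong_sets[OF sets refl] by blast
  qed
  have comp: "\<bar>l $ i\<bar> \<le> 1" if "l \<in> space \<mu>" for l i
    using that component_le_norm_cart[of l i] by (simp add: space)
  have int1: "integrable \<mu> (\<lambda>l. l $ i)" for i
    by (rule integrable_const_bound[of _ 1]) (auto intro!: meas continuous_intros AE_I2 comp)
  have int2: "integrable \<mu> (\<lambda>l. l $ i * l $ j)" for i j
  proof (rule integrable_const_bound[of _ 1])
    show "AE l in \<mu>. norm (l $ i * l $ j) \<le> 1"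
      using comp by (auto intro!: AE_I2 mult_le_one simp: abs_mult)
  qed (auto intro!: meas continuous_intros)
  let ?g = "\<lambda>l. c + (\<Sum>i\<in>UNIV. b $ i * l $ i) + (\<Sum>i\<in>UNIV. \<Sum>j\<in>UNIV. B $ i $ j * (l $ i * l $ j))"
  have "(LINT l|\<mu>. ?g l) \<ge> 0"
    using pos by (intro integral_nonneg_AE AE_I2) (simp add: space inner_vec_def)
  also have "(LINT l|\<mu>. ?g l) = c * (LINT l|\<mu>. 1) + (\<Sum>i\<in>UNIV. b $ i * (LINT l|\<mu>. l $ i)) +
      (\<Sum>i\<in>UNIV. \<Sum>j\<in>UNIV. B $ i $ j * (LINT l|\<mu>. l $ i * l $ j))"
    using int1 int2 by simp
  also have "\<dots> = 4 * pi * (c * fst M + b \<bullet> snd M +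
      (\<Sum>i\<in>UNIV. \<Sum>j\<in>UNIV. B $ i $ j * Kten cl M $ i $ j))"
    by (simp add: D I K inner_vec_def algebra_simps sum_distrib_left)
  finally show ?thesis using pi_gt_zero by (simp add: zero_le_mult_iff not_le)
qed

text \<open>These are the moments of the distribution weighted by \<open>norm w - w \<bullet> l \<ge> 0\<close>. They appear in
  the Picard iterations because \<open>1 - \<lambda> = \<lambda> * norm w\<close> for the step size
  \<open>\<lambda> = 1 / (1 + norm w)\<close>.\<close>

lemma streaming_remainder_cone:
  assumes ex: "exact_closure cl" and M: "gam M \<ge> 0"
  shows "gam (norm w * fst M - w \<bullet> snd M,
      norm w *\<^sub>R snd M - (\<chi> j. \<Sum>i\<in>UNIV. w $ i * Kten cl M $ i $ j)) \<ge> 0"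
proof -
  define y where "y = norm w *\<^sub>R snd M - (\<chi> j. \<Sum>i\<in>UNIV. w $ i * Kten cl M $ i $ j)"
  \<comment> \<open>the unit vector that turns \<open>u \<bullet> y\<close> into the norm of \<open>y\<close>; 0 if \<open>y = 0\<close>\<close>
  define u where "u = sgn y"
  have u: "norm u \<le> 1" by (simp add: u_def norm_sgn)
  have "norm w * fst M + (- w - norm w *\<^sub>R u) \<bullet> snd M +
      (\<Sum>i\<in>UNIV. \<Sum>j\<in>UNIV. (\<chi> i j. w $ i * u $ j) $ i $ j * Kten cl M $ i $ j) \<ge> 0"
  proof (rule closure_positivity[OF ex M])
    fix l :: vec3 assume l: "norm l = 1"
    have s: "(\<Sum>i\<in>UNIV. \<Sum>j\<in>UNIV. (\<chi> i j. w $ i * u $ j) $ i $ j * (l $ i * l $ j))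
        = (w \<bullet> l) * (u \<bullet> l)"
      by (simp add: inner_vec_def sum_product) (intro sum.cong refl, simp add: algebra_simps)
    have "norm w + (- w - norm w *\<^sub>R u) \<bullet> l + (w \<bullet> l) * (u \<bullet> l)
        = (norm w - w \<bullet> l) * (1 - u \<bullet> l)"
      by (simp add: algebra_simps inner_diff_left)
    moreover have "w \<bullet> l \<le> norm w" "u \<bullet> l \<le> 1"
      using norm_cauchy_schwarz[of w l] norm_cauchy_schwarz[of u l] l u by simp_all
    ultimately show "norm w + (- w - norm w *\<^sub>R u) \<bullet> l +
        (\<Sum>i\<in>UNIV. \<Sum>j\<in>UNIV. (\<chi> i j. w $ i * u $ j) $ i $ j * (l $ i * l $ j)) \<ge> 0"
      unfolding s by simp
  qed
  moreover have "(\<Sum>i\<in>UNIV. \<Sum>j\<in>UNIV. (\<chi> i j. w $ i * u $ j) $ i $ j * Kten cl M $ i $ j)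
      = u \<bullet> (\<chi> j. \<Sum>i\<in>UNIV. w $ i * Kten cl M $ i $ j)"
    unfolding inner_vec_def by (subst sum.swap) (simp add: sum_distrib_left algebra_simps)
  moreover have "u \<bullet> y = norm y"
    by (cases "y = 0") (simp_all add: u_def sgn_div_norm dot_square_norm power2_eq_square)
  ultimately show ?thesis
    unfolding gam_def y_def[symmetric] by (simp add: y_def algebra_simps inner_diff_left inner_diff_right)
qed

text \<open>The iterate is a nonnegative combination of elements of the cone, followed by damping. Since
  \<open>chi \<le> kap\<close>, the flux is damped at least as much as the density.\<close>

lemma implicit_picard_cone:
  assumes ex: "exact_closure (clos S)" and dt: "tstep S \<ge> 0"
    and op: "0 \<le> chi" "chi \<le> kap" "0 \<le> D0" and U: "gam U \<ge> 0" and M: "gam M \<ge> 0"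
  shows "gam (implicit_picard S chi kap D0 U w M) \<ge> 0"
proof -
  define lam where "lam = 1 / (1 + norm w)"
  define muchi where "muchi = 1 / (1 + lam * tstep S * chi)"
  define mukap where "mukap = 1 / (1 + lam * tstep S * kap)"
  define d where "d = norm w * fst M - w \<bullet> snd M"
  define y where "y = norm w *\<^sub>R snd M - (\<chi> j. \<Sum>i\<in>UNIV. w $ i * Kten (clos S) M $ i $ j)"
  have yd: "norm y \<le> d"
    using streaming_remainder_cone[OF ex M, of w] by (simp add: gam_def d_def y_def)
  have pos: "1 + norm w > 0" using norm_ge_zero[of w] by linarith
  then have lam: "lam > 0" and lam1: "1 - lam = lam * norm w"
    by (simp_all add: lam_def field_simps)
  have nn: "0 \<le> lam * tstep S * chi" using lam dt op by simp
  moreover have le: "lam * tstep S * chi \<le> lam * tstep S * kap"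
    using lam dt op by (intro mult_left_mono) auto
  ultimately have mu: "0 < mukap" "mukap \<le> muchi"
    unfolding mukap_def muchi_def by (simp_all add: frac_le)
  have f: "fst (implicit_picard S chi kap D0 U w M)
      = muchi * (lam * (d + fst U + tstep S * chi * D0))"
    unfolding implicit_picard_def Let_def lam_def[symmetric] muchi_def[symmetric]
    by (simp add: lam1 d_def algebra_simps)
  have s: "snd (implicit_picard S chi kap D0 U w M) = mukap *\<^sub>R (lam *\<^sub>R (y + snd U))"
    unfolding implicit_picard_def Let_def lam_def[symmetric] mukap_def[symmetric]
    by (simp add: vec_eq_iff lam1 y_def algebra_simps)
  have ys: "norm (y + snd U) \<le> d + fst U"
    using norm_triangle_ineq[of y "snd U"] yd U by (simp add: gam_def)
  have "norm (snd (implicit_picard S chi kap D0 U w M)) = mukap * (lam * norm (y + snd U))"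
    using lam mu by (simp add: s)
  also have "\<dots> \<le> mukap * (lam * (d + fst U + tstep S * chi * D0))"
    using ys lam mu dt op
    by (intro mult_left_mono) (auto intro!: order_trans[OF ys] mult_nonneg_nonneg)
  also have "\<dots> \<le> muchi * (lam * (d + fst U + tstep S * chi * D0))"
    using mu lam order_trans[OF norm_ge_zero ys] dt op by (intro mult_right_mono) auto
  finally show ?thesis by (simp add: gam_def f)
qed

text \<open>Without opacities the collision iteration is the one that recovers the primitive moments, so
  that both are covered by one invariance lemma.\<close>

lemma picard_eq_implicit_picard:
  assumes "clos S = cl"
  shows "picard cl U w = implicit_picard S 0 0 0 U w"
proof (rule ext)
  fix M
  define lam where "lam = 1 / (1 + norm w)"
  show "picard cl U w M = implicit_picard S 0 0 0 U w M"
    unfolding picard_def implicit_picard_def conserved_def Let_def lam_def[symmetric]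
    by (simp add: prod_eq_iff vec_eq_iff assms algebra_simps)
qed

lemma iteration_limit_cone:
  assumes "\<And>M. gam M \<ge> 0 \<Longrightarrow> gam (f M) \<ge> 0" and "M0 \<in> realizable"
    and "(\<lambda>n. (f ^^ n) M0) \<longlonglongrightarrow> M"
  shows "gam M \<ge> 0"
proof -
  have "gam ((f ^^ n) M0) \<ge> 0" for n
    by (induction n) (auto simp: assms(1) realizable_cone[OF assms(2)])
  then have "M \<in> {M. gam M \<ge> 0}"
    by (intro closed_sequentially[OF closed_cone _ assms(3)]) auto
  then show ?thesis by simp
qed

lemma primitive_cone:
  assumes ex: "exact_closure cl" and U: "gam U \<ge> 0" and prim: "is_primitive cl U w M"
  shows "gam M \<ge> 0"
proof -
  \<comment> \<open>a carrier for the closure, as the collision iteration refers to a discretization\<close>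
  define S where "S = (undefined :: dgdata)\<lparr>clos := cl, tstep := 0\<rparr>"
  have S: "clos S = cl" "tstep S = 0" by (simp_all add: S_def)
  obtain M0 where M0: "M0 \<in> realizable" "(\<lambda>n. (picard cl U w ^^ n) M0) \<longlonglongrightarrow> M"
    using prim unfolding is_primitive_def by blast
  show ?thesis
  proof (rule iteration_limit_cone[OF _ M0])
    fix M' assume "gam M' \<ge> 0"
    then show "gam (picard cl U w M') \<ge> 0"
      unfolding picard_eq_implicit_picard[OF S(1)]
      using ex U S by (intro implicit_picard_cone) auto
  qed
qed

lemma conserved_density_ge:
  assumes "gam M \<ge> 0"
  shows "fst (conserved cl w M) \<ge> (1 - norm w) * fst M"
proof -
  have "- (w \<bullet> snd M) \<le> norm w * norm (snd M)"
    using norm_cauchy_schwarz[of "- w" "snd M"] by simp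
  also have "\<dots> \<le> norm w * fst M"
    using assms by (intro mult_left_mono) (auto simp: gam_def)
  finally show ?thesis by (simp add: conserved_def algebra_simps)
qed


section \<open>The spectral bound for the energy flux\<close>

lemma symmetric_matrix_inner:
  fixes A :: "real ^ 'n ^ 'n"
  assumes "transpose A = A"
  shows "(A *v x) \<bullet> y = x \<bullet> (A *v y)"
  by (metis assms dot_lmul_matrix transpose_matrix_vector)

text \<open>Eigenvectors for distinct eigenvalues are orthogonal. Finiteness is needed because
  \<open>alpha_eps\<close> is a \<open>Max\<close>.\<close>

lemma finite_symmetric_eigenvalues:
  fixes A :: "real ^ 'n ^ 'n"
  assumes sym: "transpose A = A"
  shows "finite {l. \<exists>x. x \<noteq> 0 \<and> A *v x = l *\<^sub>R x}"
proof -
  let ?E = "{l. \<exists>x. x \<noteq> 0 \<and> A *v x = l *\<^sub>R x}"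
  define f where "f l = (SOME x. x \<noteq> 0 \<and> A *v x = l *\<^sub>R x)" for l
  have f: "f l \<noteq> 0 \<and> A *v f l = l *\<^sub>R f l" if "l \<in> ?E" for l
    unfolding f_def by (rule someI_ex) (use that in simp)
  have orth: "f l \<bullet> f m = 0" if "l \<in> ?E" "m \<in> ?E" "l \<noteq> m" for l m
  proof -
    have "l * (f l \<bullet> f m) = (A *v f l) \<bullet> f m" using f[OF that(1)] by simp
    also have "\<dots> = m * (f l \<bullet> f m)"
      using f[OF that(2)] by (simp add: symmetric_matrix_inner[OF sym])
    finally show ?thesis using that(3) by simp
  qed
  have inj: "inj_on f ?E"
  proof (rule inj_onI, rule ccontr)
    fix l m assume lm: "l \<in> ?E" "m \<in> ?E" "f l = f m" "l \<noteq> m"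
    then have "f l \<bullet> f l = 0" using orth[of l m] by simp
    then show False using f[OF lm(1)] by simp
  qed
  have "pairwise orthogonal (f ` ?E)"
    unfolding pairwise_def orthogonal_def using orth by blast
  then have "finite (f ` ?E)" by (rule pairwise_orthogonal_imp_finite)
  then show ?thesis using inj by (rule finite_imageD)
qed

text \<open>The form \<open>m |y|\<^sup>2 - y \<bullet> (A *v y)\<close> is nonnegative and vanishes at \<open>u\<close>, hence so does its
  gradient there.\<close>

lemma extremal_eigenvector:
  fixes A :: "real ^ 'n ^ 'n"
  assumes sym: "transpose A = A" and u: "norm u = 1"
    and max: "\<And>y. norm y = 1 \<Longrightarrow> y \<bullet> (A *v y) \<le> u \<bullet> (A *v u)"
  shows "A *v u = (u \<bullet> (A *v u)) *\<^sub>R u"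
proof -
  define m where "m = u \<bullet> (A *v u)"
  define B where "B y = m *\<^sub>R y - A *v y" for y
  have lin: "B (y + t *\<^sub>R z) = B y + t *\<^sub>R B z" for y z t
    by (simp add: B_def algebra_simps matrix_vector_right_distrib matrix_vector_mult_scaleR)
  have psd: "y \<bullet> B y \<ge> 0" for y
  proof (cases "y = 0")
    case False
    have "y \<bullet> (A *v y) = (norm y)\<^sup>2 * ((y /\<^sub>R norm y) \<bullet> (A *v (y /\<^sub>R norm y)))"
      using False by (simp add: matrix_vector_mult_scaleR power2_eq_square divide_simps)
    also have "\<dots> \<le> (norm y)\<^sup>2 * m"
      unfolding m_def using False by (intro mult_left_mono max) auto
    finally show ?thesis
      by (simp add: B_def inner_diff_right dot_square_norm algebra_simps)
  qed (simp add: B_def)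
  have u0: "u \<bullet> B u = 0"
    using u by (simp add: B_def m_def inner_diff_right dot_square_norm)
  define z where "z = B u"
  have "u \<bullet> B z = B u \<bullet> z"
    by (simp add: B_def inner_diff_right inner_diff_left symmetric_matrix_inner[OF sym])
  then have sb: "u \<bullet> B z = z \<bullet> z" by (simp add: z_def)
  define g where "g = z \<bullet> B z"
  have g: "g \<ge> 0" unfolding g_def by (rule psd)
  have quad: "2 * t * (z \<bullet> z) + t\<^sup>2 * g \<ge> 0" for t
  proof -
    have "(u + t *\<^sub>R z) \<bullet> B (u + t *\<^sub>R z) = 2 * t * (z \<bullet> z) + t\<^sup>2 * g"
      using u0 sb unfolding lin z_def[symmetric]
      by (simp add: inner_add_left inner_add_right g_def power2_eq_square algebra_simps z_def[symmetric])
    then show ?thesis using psd[of "u + t *\<^sub>R z"] by simp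
  qed
  have "z \<bullet> z = 0"
  proof -
    \<comment> \<open>slightly shorter than the minimiser of the parabola, so that \<open>g = 0\<close> is covered\<close>
    define t where "t = - (z \<bullet> z) / (g + 1)"
    have "2 * t * (z \<bullet> z) + t\<^sup>2 * g = - ((z \<bullet> z) / (g + 1))\<^sup>2 * (g + 2)"
      using g by (simp add: t_def power2_eq_square divide_simps) (simp add: algebra_simps)
    then have "((z \<bullet> z) / (g + 1))\<^sup>2 * (g + 2) \<le> 0" using quad[of t] by simp
    then show ?thesis using g by (simp add: mult_le_0_iff)
  qed
  then show ?thesis by (simp add: z_def B_def m_def)
qed

text \<open>The maximum and the minimum of the form over the unit sphere are attained and are
  eigenvalues.\<close>

lemma quadratic_form_le_spectral_radius:
  fixes A :: "real ^ 'n ^ 'n"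
  assumes sym: "transpose A = A"
  defines "r \<equiv> Max {\<bar>l\<bar> | l. \<exists>x. x \<noteq> 0 \<and> A *v x = l *\<^sub>R x}"
  shows "norm y = 1 \<Longrightarrow> \<bar>y \<bullet> (A *v y)\<bar> \<le> r" and "r \<ge> 0"
proof -
  let ?E = "{l. \<exists>x. x \<noteq> 0 \<and> A *v x = l *\<^sub>R x}"
  have r: "r = Max (abs ` ?E)" unfolding r_def by (rule arg_cong[of _ _ Max]) auto
  have fin: "finite (abs ` ?E)" using finite_symmetric_eigenvalues[OF sym] by simp
  have le: "\<bar>u \<bullet> (A *v u)\<bar> \<le> r" if "norm u = 1" "A *v u = (u \<bullet> (A *v u)) *\<^sub>R u" for u
    unfolding r using that fin by (intro Max_ge) (auto intro!: imageI exI[of _ u])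
  have ne: "sphere (0 :: real ^ 'n) 1 \<noteq> {}" by simp
  have cont: "continuous_on (sphere 0 1) (\<lambda>y. y \<bullet> (A *v y))"
    by (intro continuous_intros)
  obtain u where u: "norm u = 1" "\<And>y. norm y = 1 \<Longrightarrow> y \<bullet> (A *v y) \<le> u \<bullet> (A *v u)"
    using continuous_attains_sup[OF compact_sphere ne cont] by auto
  obtain v where v: "norm v = 1" "\<And>y. norm y = 1 \<Longrightarrow> v \<bullet> (A *v v) \<le> y \<bullet> (A *v y)"
    using continuous_attains_inf[OF compact_sphere ne cont] by auto
  have neg: "(- A) *v y = - (A *v y)" for y
    by (simp add: matrix_vector_mult_def vec_eq_iff sum_negf)
  have lu: "\<bar>u \<bullet> (A *v u)\<bar> \<le> r" using extremal_eigenvector[OF sym u] by (intro le u)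
  have "transpose (- A) = - A" using sym by (simp add: transpose_def vec_eq_iff)
  from extremal_eigenvector[OF this v(1)] have "A *v v = (v \<bullet> (A *v v)) *\<^sub>R v"
    using v(2) by (simp add: neg)
  then have lv: "\<bar>v \<bullet> (A *v v)\<bar> \<le> r" using v(1) by (intro le)
  show "\<bar>y \<bullet> (A *v y)\<bar> \<le> r" if "norm y = 1"
    using u(2)[OF that] v(2)[OF that] lu lv by linarith
  show "r \<ge> 0" using lu by linarith
qed

lemma transpose_Amat: "transpose (Amat dv) = Amat dv"
  by (simp add: Amat_def transpose_def vec_eq_iff algebra_simps)

lemma alpha_eps_nonneg: "alpha_eps dv \<ge> 0"
  unfolding alpha_eps_def by (rule quadratic_form_le_spectral_radius(2)[OF transpose_Amat])

lemma Amat_quadratic_form: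
  "l \<bullet> (Amat dv *v l) = - (\<Sum>i\<in>UNIV. \<Sum>j\<in>UNIV. dv $ i $ j * (l $ i * l $ j))"
proof -
  have "l \<bullet> (Amat dv *v l) = - (1 / 2) * ((\<Sum>i\<in>UNIV. \<Sum>j\<in>UNIV. dv $ i $ j * (l $ i * l $ j))
      + (\<Sum>i\<in>UNIV. \<Sum>j\<in>UNIV. dv $ j $ i * (l $ i * l $ j)))"
    by (simp add: inner_vec_def matrix_vector_mult_def Amat_def sum_distrib_left
        sum.distrib[symmetric] algebra_simps sum_negf[symmetric] add_divide_distrib
        sum_divide_distrib)
  also have "(\<Sum>i\<in>UNIV. \<Sum>j\<in>UNIV. dv $ j $ i * (l $ i * l $ j))
      = (\<Sum>i\<in>UNIV. \<Sum>j\<in>UNIV. dv $ i $ j * (l $ i * l $ j))"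
    by (subst sum.swap) (simp add: mult.commute)
  finally show ?thesis by simp
qed

lemma energy_flux_bound:
  assumes ex: "exact_closure cl" and M: "gam M \<ge> 0"
  shows "\<bar>fst (Feps cl dv M)\<bar> \<le> alpha_eps dv * fst M"
proof -
  have bound: "\<bar>\<Sum>i\<in>UNIV. \<Sum>j\<in>UNIV. dv $ i $ j * (l $ i * l $ j)\<bar> \<le> alpha_eps dv"
    if "norm l = 1" for l
    using quadratic_form_le_spectral_radius(1)[OF transpose_Amat that, of dv]
    by (simp add: Amat_quadratic_form alpha_eps_def)
  have "alpha_eps dv * fst M + 0 \<bullet> snd M + (\<Sum>i\<in>UNIV. \<Sum>j\<in>UNIV. dv $ i $ j * Kten cl M $ i $ j) \<ge> 0"
  proof (rule closure_positivity[OF ex M])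
    fix l :: vec3 assume "norm l = 1"
    from bound[OF this] show "alpha_eps dv + 0 \<bullet> l + (\<Sum>i\<in>UNIV. \<Sum>j\<in>UNIV. dv $ i $ j * (l $ i * l $ j)) \<ge> 0"
      by simp
  qed
  moreover have "alpha_eps dv * fst M + 0 \<bullet> snd M
      + (\<Sum>i\<in>UNIV. \<Sum>j\<in>UNIV. (- dv) $ i $ j * Kten cl M $ i $ j) \<ge> 0"
  proof (rule closure_positivity[OF ex M])
    fix l :: vec3 assume "norm l = 1"
    from bound[OF this] show "alpha_eps dv + 0 \<bullet> l + (\<Sum>i\<in>UNIV. \<Sum>j\<in>UNIV. (- dv) $ i $ j * (l $ i * l $ j)) \<ge> 0"
      by (simp add: sum_negf)
  qed
  ultimately show ?thesis by (simp add: Feps_def sum_negf mult.commute abs_le_iff)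
qed


section \<open>One-sided number fluxes\<close>

text \<open>This is where the factor \<open>1 - norm w\<close> of the spatial time step restriction comes from;
  \<open>sg\<close> is the sign of the outer normal. The difference of the two sides is a linear form
  \<open>(1 - s) * fst M + u \<bullet> snd M\<close>, nonnegative on the cone iff \<open>norm u \<le> 1 - s\<close>, and
  \<open>(1 - s)\<^sup>2 - (norm u)\<^sup>2 = (1 - r) * (r + a\<^sup>2)\<close> for \<open>r = norm w\<close> and \<open>a = sg * w $ i\<close>.\<close>

lemma outflow_le_density:
  fixes sg :: real
  assumes M: "gam M \<ge> 0" and w: "norm w \<le> 1" and sg: "sg = 1 \<or> sg = -1"
  shows "(1 - norm w) * ((1 + sg * w $ i) * (fst M + sg * snd M $ i) / 2) \<le> fst M + w \<bullet> snd M"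
proof -
  define r where "r = norm w"
  define a where "a = sg * w $ i"
  define s where "s = (1 - r) * (1 + a) / 2"
  define u where "u = w - (s * sg) *\<^sub>R axis i 1"
  have r: "0 \<le> r" "r \<le> 1" using w by (simp_all add: r_def)
  have ar: "\<bar>a\<bar> \<le> r"
    using component_le_norm_cart[of w i] sg by (auto simp: a_def r_def abs_mult)
  have sg2: "sg * sg = 1" using sg by auto
  define e :: vec3 where "e = axis i 1"
  have "e \<bullet> e = 1" "w \<bullet> e = w $ i" by (simp_all add: e_def inner_axis)
  then have "u \<bullet> u = w \<bullet> w - 2 * s * (sg * w $ i) + s\<^sup>2 * (sg * sg)"
    unfolding u_def e_def[symmetric]
    by (simp add: inner_diff_left inner_diff_right inner_commute[of e w] power2_eq_square algebra_simps)
  then have "u \<bullet> u = r\<^sup>2 - 2 * s * a + s\<^sup>2"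
    by (simp add: sg2 a_def r_def dot_square_norm)
  moreover have "(1 - s)\<^sup>2 - (r\<^sup>2 - 2 * s * a + s\<^sup>2) = (1 - r) * (r + a\<^sup>2)"
    by (simp add: s_def power2_eq_square field_simps)
  moreover have "(1 - r) * (r + a\<^sup>2) \<ge> 0" using r by (intro mult_nonneg_nonneg) auto
  ultimately have "(norm u)\<^sup>2 \<le> (1 - s)\<^sup>2" by (simp add: dot_square_norm)
  moreover have s1: "s \<le> 1"
  proof -
    have "(1 - r) * (1 + a) \<le> 1 * 2" using r ar by (intro mult_mono) auto
    then show ?thesis by (simp add: s_def)
  qed
  ultimately have u: "norm u \<le> 1 - s" by (simp add: abs_le_square_iff[symmetric])
  have "- (u \<bullet> snd M) \<le> norm u * norm (snd M)"
    using norm_cauchy_schwarz[of "- u" "snd M"] by simp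
  also have "\<dots> \<le> (1 - s) * fst M"
    using u M s1 by (intro mult_mono) (auto simp: gam_def)
  finally have "s * (fst M + sg * snd M $ i) \<le> fst M + w \<bullet> snd M"
    by (simp add: u_def inner_diff_left inner_axis' algebra_simps)
  then show ?thesis by (simp add: s_def r_def a_def algebra_simps)
qed


section \<open>Tensor-product quadrature\<close>

lemma finite_vec_box:
  assumes "\<And>c. finite (F c)"
  shows "finite {z :: real ^ 'n. \<forall>c. z $ c \<in> F c}"
proof -
  have "{z :: real ^ 'n. \<forall>c. z $ c \<in> F c} \<subseteq> vec_lambda ` PiE UNIV F"
  proof
    fix z :: "real ^ 'n" assume "z \<in> {z. \<forall>c. z $ c \<in> F c}"
    then have "(\<lambda>c. z $ c) \<in> PiE UNIV F" by auto
    moreover have "z = vec_lambda (\<lambda>c. z $ c)" by simp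
    ultimately show "z \<in> vec_lambda ` PiE UNIV F" by (metis image_eqI)
  qed
  moreover have "finite (vec_lambda ` PiE UNIV F)"
    using assms by (intro finite_imageI finite_PiE) auto
  ultimately show ?thesis by (rule finite_subset)
qed

lemma finite_tnodes: "finite (tnodes k C K)"
  by (rule finite_subset[OF _ finite_vec_box[of "\<lambda>c. if c \<in> C then lg_nodes (k + 1) (fst K $ c) (snd K $ c) else {0}"]])
     (auto simp: tnodes_def lg_nodes_finite)

lemma finite_all_points:
  assumes "kh \<ge> 2"
  shows "finite (all_points k kh C K)"
proof -
  have "finite (tnodes_lgl k kh C c K)" if "c \<in> C" for c
    by (rule finite_subset[OF _ finite_vec_box[of "\<lambda>c'. if c' = c then lgl_nodes kh (fst K $ c) (snd K $ c)
          else if c' \<in> C then lg_nodes (k + 1) (fst K $ c') (snd K $ c') else {0}"]])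
       (use that assms in \<open>auto simp: tnodes_lgl_def lg_nodes_finite lgl_nodes_finite\<close>)
  then show ?thesis by (simp add: all_points_def finite_tnodes)
qed

lemma tnodes_nonempty: "tnodes k C K \<noteq> {}"
proof -
  define z :: point where
    "z = (\<chi> c. if c \<in> C then SOME s. s \<in> lg_nodes (k + 1) (fst K $ c) (snd K $ c) else 0)"
  have "(SOME s. s \<in> lg_nodes (k + 1) a b) \<in> lg_nodes (k + 1) a b" for a b
    using lg_nodes_nonempty[of "k + 1" a b] by (simp add: some_in_eq)
  then have "z \<in> tnodes k C K" by (simp add: tnodes_def z_def)
  then show ?thesis by blast
qed

lemma upd_nth: "upd z c s $ c' = (if c' = c then s else z $ c')"
  by (simp add: upd_def)

definition node_weight :: "nat \<Rightarrow> cell \<Rightarrow> coord \<Rightarrow> real \<Rightarrow> real" where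
  "node_weight k K c s = width K c *
     qweight (lg_nodes (k + 1) (fst K $ c) (snd K $ c)) (fst K $ c) (snd K $ c) s"

lemma tquad_node_weight:
  "tquad k C K g = (\<Sum>z\<in>tnodes k C K. (\<Prod>c\<in>C. node_weight k K c (z $ c)) *\<^sub>R g z)"
  by (simp add: tquad_def node_weight_def)

lemma tensor_weight_pos:
  assumes "\<And>c. c \<in> C \<Longrightarrow> fst K $ c < snd K $ c" and "z \<in> tnodes k C K"
  shows "(\<Prod>c\<in>C. node_weight k K c (z $ c)) > 0"
  using assms
  by (intro prod_pos) (auto simp: node_weight_def width_def tnodes_def intro!: mult_pos_pos lg_qweight_pos)

lemma tquad_mono:
  fixes f g :: "point \<Rightarrow> real"
  assumes "\<And>c. c \<in> C \<Longrightarrow> fst K $ c < snd K $ c"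
    and "\<And>z. z \<in> tnodes k C K \<Longrightarrow> f z \<le> g z"
  shows "tquad k C K f \<le> tquad k C K g"
  unfolding tquad_node_weight using assms tensor_weight_pos[of C K]
  by (intro sum_mono) (auto intro!: mult_left_mono less_imp_le)

lemma tquad_pos:
  fixes f :: "point \<Rightarrow> real"
  assumes "\<And>c. c \<in> C \<Longrightarrow> fst K $ c < snd K $ c"
    and "\<And>z. z \<in> tnodes k C K \<Longrightarrow> f z > 0"
  shows "tquad k C K f > 0"
  unfolding tquad_node_weight using assms tensor_weight_pos[of C K]
  by (intro sum_pos finite_tnodes tnodes_nonempty) (auto intro!: mult_pos_pos)

lemma tquad_add: "tquad k C K (\<lambda>z. f z + g z) = tquad k C K f + tquad k C K g"
  by (simp add: tquad_def scaleR_add_right sum.distrib)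

lemma tquad_scale: "tquad k C K (\<lambda>z. c * f z) = c * tquad k C K f" for c :: real
  by (simp add: tquad_def sum_distrib_left algebra_simps)

lemma tquad_0: "tquad k C K (\<lambda>z. 0) = 0"
  by (simp add: tquad_def)

lemma fst_tquad: "fst (tquad k C K g) = tquad k C K (\<lambda>z. fst (g z))"
  by (simp add: tquad_def fst_sum)

text \<open>Fubini's theorem for the tensor-product rule.\<close>

lemma tquad_split:
  assumes c: "c \<in> C"
  shows "tquad k C K g = tquad k (C - {c}) K (\<lambda>z.
    \<Sum>s\<in>lg_nodes (k + 1) (fst K $ c) (snd K $ c). node_weight k K c s *\<^sub>R g (upd z c s))"
proof -
  let ?X = "lg_nodes (k + 1) (fst K $ c) (snd K $ c)" and ?T = "tnodes k (C - {c}) K"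
  let ?w = "\<lambda>C z. \<Prod>c'\<in>C. node_weight k K c' (z $ c')"
  have w: "?w C (upd z c s) = ?w (C - {c}) z * node_weight k K c s" for z s
  proof -
    have "?w C (upd z c s) = node_weight k K c s * ?w (C - {c}) (upd z c s)"
      using c by (subst prod.remove[of C c]) (auto simp: upd_nth)
    also have "?w (C - {c}) (upd z c s) = ?w (C - {c}) z"
      by (intro prod.cong) (auto simp: upd_nth)
    finally show ?thesis by simp
  qed
  have "tquad k C K g = (\<Sum>p\<in>?T \<times> ?X. (?w (C - {c}) (fst p) * node_weight k K c (snd p)) *\<^sub>R
      g (upd (fst p) c (snd p)))"
    unfolding tquad_node_weight
  proof (rule sum.reindex_bij_witness[of _ "\<lambda>p. upd (fst p) c (snd p)" "\<lambda>z. (upd z c 0, z $ c)"])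
    fix z assume z: "z \<in> tnodes k C K"
    show zz: "upd (fst (upd z c 0, z $ c)) c (snd (upd z c 0, z $ c)) = z"
      by (simp add: vec_eq_iff upd_nth)
    show "(upd z c 0, z $ c) \<in> ?T \<times> ?X"
      using z c by (auto simp: tnodes_def upd_nth)
    show "(?w (C - {c}) (fst (upd z c 0, z $ c)) * node_weight k K c (snd (upd z c 0, z $ c))) *\<^sub>R
        g (upd (fst (upd z c 0, z $ c)) c (snd (upd z c 0, z $ c))) = ?w C z *\<^sub>R g z"
      unfolding w[symmetric] zz ..
  next
    fix p assume p: "p \<in> ?T \<times> ?X"
    then have z: "fst p \<in> ?T" and s: "snd p \<in> ?X" by auto
    show "(upd (upd (fst p) c (snd p)) c 0, upd (fst p) c (snd p) $ c) = p"
      using z by (auto simp: prod_eq_iff vec_eq_iff upd_nth tnodes_def)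
    show "upd (fst p) c (snd p) \<in> tnodes k C K"
      using z s c by (auto simp: tnodes_def upd_nth)
  qed
  also have "\<dots> = (\<Sum>z\<in>?T. \<Sum>s\<in>?X. (?w (C - {c}) z * node_weight k K c s) *\<^sub>R g (upd z c s))"
    by (simp add: sum.cartesian_product split_beta)
  finally show ?thesis by (simp add: tquad_node_weight scaleR_sum_right)
qed

lemma tensor_poly_along_line:
  assumes p: "tensor_poly k C p" and c: "c \<in> C"
  obtains q where "degree q \<le> k" "\<And>s. p (upd z c s) = poly q s"
proof -
  let ?I = "PiE C (\<lambda>_. {..k})"
  obtain a where a: "\<And>z. p z = (\<Sum>m\<in>?I. a m * (\<Prod>c\<in>C. z $ c ^ m c))"
    using p unfolding tensor_poly_def by blast
  define q where "q = (\<Sum>m\<in>?I. monom (a m * (\<Prod>c'\<in>C - {c}. z $ c' ^ m c')) (m c))"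
  have "finite ?I" by (intro finite_PiE) auto
  then have "degree q \<le> k"
    unfolding q_def using c
    by (intro degree_sum_le) (auto intro!: order_trans[OF degree_monom_le] simp: PiE_def Pi_def)
  moreover have "p (upd z c s) = poly q s" for s
  proof -
    have "(\<Prod>c'\<in>C. upd z c s $ c' ^ m c') = s ^ m c * (\<Prod>c'\<in>C - {c}. z $ c' ^ m c')" for m
    proof -
      have "(\<Prod>c'\<in>C. upd z c s $ c' ^ m c') = s ^ m c * (\<Prod>c'\<in>C - {c}. upd z c s $ c' ^ m c')"
        using c by (subst prod.remove[of C c]) (auto simp: upd_nth)
      also have "(\<Prod>c'\<in>C - {c}. upd z c s $ c' ^ m c') = (\<Prod>c'\<in>C - {c}. z $ c' ^ m c')"
        by (intro prod.cong) (auto simp: upd_nth)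
      finally show ?thesis .
    qed
    then show ?thesis by (simp add: a q_def poly_sum poly_monom algebra_simps)
  qed
  ultimately show thesis by (rule that)
qed

lemma tensor_poly_const: "tensor_poly k C (\<lambda>_. 1)"
  unfolding tensor_poly_def
proof (intro exI allI)
  fix z :: point
  let ?I = "PiE C (\<lambda>_. {..k})" and ?z = "\<lambda>c\<in>C. 0 :: nat"
  have "finite ?I" by (intro finite_PiE) auto
  moreover have "?z \<in> ?I" by auto
  ultimately have "(\<Sum>m\<in>?I. (if m = ?z then \<Prod>c\<in>C. z $ c ^ ?z c else 0)) = 1"
    by simp
  also have "(\<Sum>m\<in>?I. (if m = ?z then \<Prod>c\<in>C. z $ c ^ ?z c else 0))
      = (\<Sum>m\<in>?I. (if m = ?z then 1 else 0) * (\<Prod>c\<in>C. z $ c ^ m c))"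
    by (intro sum.cong) auto
  finally show "1 = (\<Sum>m\<in>?I. (if m = ?z then 1 else 0) * (\<Prod>c\<in>C. z $ c ^ m c))" ..
qed

text \<open>The one-dimensional estimates, applied on every line through the element in direction \<open>c\<close>.
  In the energy direction the weight \<open>tau\<close> varies along the line, in the spatial directions
  it is constant.\<close>

lemma tquad_ge_faces:
  assumes box: "\<And>c. c \<in> C \<Longrightarrow> fst K $ c < snd K $ c" and E: "0 \<le> fst K $ None"
    and c: "c \<in> C" and n: "2 * n \<ge> k + 5" and p: "tensor_poly k C p"
    and nn: "\<And>z s. z \<in> tnodes k (C - {c}) K \<Longrightarrow> s \<in> lgl_nodes n (fst K $ c) (snd K $ c) \<Longrightarrow>
      p (upd z c s) \<ge> 0"
  shows "tquad k C K (\<lambda>z. tau z * p z) \<ge> lgl_end_weight n * width K c *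
    (fquad k C K c True (\<lambda>z. tau z * p z) + fquad k C K c False (\<lambda>z. tau z * p z))"
proof -
  let ?a = "fst K $ c" and ?b = "snd K $ c"
  let ?f = "\<lambda>z s. tau (upd z c s) * p (upd z c s)"
  have ab: "?a < ?b" using box c by simp
  have wd: "width K c > 0" using ab by (simp add: width_def)
  have pt: "lg_average k ?a ?b (?f z) \<ge> lgl_end_weight n * (?f z ?a + ?f z ?b)"
    if z: "z \<in> tnodes k (C - {c}) K" for z
  proof -
    obtain q where q: "degree q \<le> k" "\<And>s. p (upd z c s) = poly q s"
      using tensor_poly_along_line[OF p c, of z] by blast
    have qn: "poly q s \<ge> 0" if "s \<in> lgl_nodes n ?a ?b" for s
      using nn[OF z that] by (simp add: q)
    show ?thesis
    proof (cases c)
      case None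
      then have f: "?f z s = s\<^sup>2 * poly q s" for s using q(2) by (simp add: tau_def upd_nth)
      have "fst K $ c \<ge> 0" using E None by simp
      from lg_average_energy_ge_ends[OF this ab n q(1) qn] show ?thesis by (simp only: f)
    next
      case (Some i)
      let ?q = "smult (tau z) q"
      have f: "?f z s = poly ?q s" for s using Some q(2) by (simp add: tau_def upd_nth)
      have d: "degree ?q \<le> k" using degree_smult_le[of "tau z" q] q(1) by simp
      have "lg_average k ?a ?b (poly ?q) \<ge> lgl_end_weight n * (poly ?q ?a + poly ?q ?b)"
      proof (rule lg_average_ge_ends[OF ab])
        show "poly ?q s \<ge> 0" if "s \<in> lgl_nodes n ?a ?b" for s
          using qn[OF that] by (simp add: tau_def)
      qed (use n d in auto)
      then show ?thesis by (simp only: f)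
    qed
  qed
  have "lgl_end_weight n * width K c *
      (fquad k C K c True (\<lambda>z. tau z * p z) + fquad k C K c False (\<lambda>z. tau z * p z))
    = tquad k (C - {c}) K (\<lambda>z. width K c * (lgl_end_weight n * (?f z ?a + ?f z ?b)))"
    by (simp add: fquad_def face_def tquad_add tquad_scale algebra_simps)
  also have "\<dots> \<le> tquad k (C - {c}) K (\<lambda>z. width K c * lg_average k ?a ?b (?f z))"
    using pt wd box by (intro tquad_mono mult_left_mono) auto
  also have "\<dots> = tquad k C K (\<lambda>z. tau z * p z)"
    by (subst tquad_split[OF c]) (simp add: lg_average_def node_weight_def sum_distrib_left mult.assoc)
  finally show ?thesis .
qed

text \<open>The bookkeeping for one coordinate direction: the share \<open>g\<close> of the element mass pays for
  the outflow through the two faces orthogonal to \<open>c\<close>.\<close>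

lemma face_balance:
  assumes box: "\<And>c. c \<in> C \<Longrightarrow> fst K $ c < snd K $ c" and E: "0 \<le> fst K $ None"
    and c: "c \<in> C" and n: "2 * n \<ge> k + 5" and p: "tensor_poly k C p"
    and nn: "\<And>z s. z \<in> tnodes k (C - {c}) K \<Longrightarrow> s \<in> lgl_nodes n (fst K $ c) (snd K $ c) \<Longrightarrow>
      p (upd z c s) \<ge> 0"
    and g: "g \<ge> 0"
    and out: "\<And>z up. z \<in> tnodes k (C - {c}) K \<Longrightarrow>
      dt * ((if up then 1 else -1) * F up (upd z c (face K c up)))
        \<le> g * lgl_end_weight n * width K c * (tau (upd z c (face K c up)) * p (upd z c (face K c up)))"
  shows "dt * (fquad k C K c True (F True) - fquad k C K c False (F False))
    \<le> g * tquad k C K (\<lambda>z. tau z * p z)"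
proof -
  let ?G = "g * lgl_end_weight n * width K c"
  have fq: "dt * ((if up then 1 else -1) * fquad k C K c up (F up))
      \<le> ?G * fquad k C K c up (\<lambda>z. tau z * p z)" for up
    unfolding fquad_def tquad_scale[symmetric] using out box by (intro tquad_mono) auto
  have "dt * (fquad k C K c True (F True) - fquad k C K c False (F False))
      \<le> g * (lgl_end_weight n * width K c *
        (fquad k C K c True (\<lambda>z. tau z * p z) + fquad k C K c False (\<lambda>z. tau z * p z)))"
    using fq[of True] fq[of False] by (simp add: algebra_simps)
  also have "\<dots> \<le> g * tquad k C K (\<lambda>z. tau z * p z)"
    using tquad_ge_faces[OF box E c n p nn] g by (intro mult_left_mono) auto
  finally show ?thesis .
qed


section \<open>Elements, faces and traces\<close>

lemma None_notin_xcoords: "None \<notin> xcoords S"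
  by (auto simp: xcoords_def)

lemma None_in_coords: "None \<in> coords S"
  by (simp add: coords_def)

lemma Some_in_coords: "Some i \<in> coords S \<longleftrightarrow> i \<in> xdims S"
  by (auto simp: coords_def xcoords_def)

lemma cell_geometry:
  assumes mesh: "mesh S" and K: "K \<in> cells S"
  shows "sbox K \<in> xmesh S"
    and "\<And>c. c \<in> coords S \<Longrightarrow> fst K $ c < snd K $ c"
    and "\<And>c. c \<notin> coords S \<Longrightarrow> fst K $ c = 0 \<and> snd K $ c = 0"
    and "0 \<le> fst K $ None"
proof -
  obtain e B where e: "e \<in> emesh S" and B: "B \<in> xmesh S"
      and Keq: "K = (upd (fst B) None (fst e), upd (snd B) None (snd e))"
    using K unfolding cells_def by blast
  have ee: "0 \<le> fst e" "fst e < snd e" using mesh e unfolding mesh_def by blast+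
  have Bx: "\<And>c. c \<in> xcoords S \<Longrightarrow> fst B $ c < snd B $ c"
      "\<And>c. c \<notin> xcoords S \<Longrightarrow> fst B $ c = 0 \<and> snd B $ c = 0"
    using mesh B unfolding mesh_def by blast+
  have "spat (fst K) = fst B" "spat (snd K) = snd B"
    using Bx(2)[OF None_notin_xcoords] by (simp_all add: Keq spat_def vec_eq_iff upd_nth)
  then show "sbox K \<in> xmesh S" using B by (simp add: sbox_def)
  show "fst K $ c < snd K $ c" if "c \<in> coords S" for c
    using that ee Bx(1) by (cases c) (auto simp: Keq upd_nth coords_def)
  show "fst K $ c = 0 \<and> snd K $ c = 0" if "c \<notin> coords S" for c
    using that Bx(2) by (auto simp: Keq upd_nth coords_def)
  show "0 \<le> fst K $ None" using ee by (simp add: Keq upd_nth)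
qed

lemma spat_in_closed_box:
  assumes "\<And>c. c \<in> coords S \<Longrightarrow> fst K $ c \<le> z $ c \<and> z $ c \<le> snd K $ c"
    and "\<And>c. c \<notin> coords S \<Longrightarrow> z $ c = 0"
    and "\<And>c. c \<notin> coords S \<Longrightarrow> fst K $ c = 0 \<and> snd K $ c = 0"
  shows "spat z \<in> closed_box (sbox K)"
  unfolding closed_box_def mem_box_cart
proof
  fix c show "fst (sbox K) $ c \<le> spat z $ c \<and> spat z $ c \<le> snd (sbox K) $ c"
    using assms(1)[of c] assms(2)[of c] assms(3)[of c]
    by (cases "c \<in> coords S") (auto simp: sbox_def spat_def upd_nth)
qed

lemma node_in_closed_box:
  assumes mesh: "mesh S" and K: "K \<in> cells S" and z: "z \<in> tnodes k (coords S) K"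
  shows "spat z \<in> closed_box (sbox K)"
proof (rule spat_in_closed_box)
  fix c assume c: "c \<in> coords S"
  then have "z $ c \<in> lg_nodes (k + 1) (fst K $ c) (snd K $ c)" using z by (simp add: tnodes_def)
  from lg_nodes_interior[OF cell_geometry(2)[OF mesh K c] this]
  show "fst K $ c \<le> z $ c \<and> z $ c \<le> snd K $ c" by simp
qed (use z cell_geometry(3)[OF mesh K] in \<open>auto simp: tnodes_def\<close>)

lemma face_node_in_closed_box:
  assumes mesh: "mesh S" and K: "K \<in> cells S" and c: "c \<in> coords S"
    and z: "z \<in> tnodes k (coords S - {c}) K"
  shows "spat (upd z c (face K c up)) \<in> closed_box (sbox K)"
proof (rule spat_in_closed_box)
  fix c' assume c': "c' \<in> coords S"
  note lt = cell_geometry(2)[OF mesh K c']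
  show "fst K $ c' \<le> upd z c (face K c up) $ c' \<and> upd z c (face K c up) $ c' \<le> snd K $ c'"
  proof (cases "c' = c")
    case False
    then have "z $ c' \<in> lg_nodes (k + 1) (fst K $ c') (snd K $ c')"
      using z c' by (simp add: tnodes_def)
    from lg_nodes_interior[OF lt this] show ?thesis using False by (simp add: upd_nth)
  qed (use lt in \<open>auto simp: upd_nth face_def\<close>)
qed (use z c cell_geometry(3)[OF mesh K] in \<open>auto simp: tnodes_def upd_nth\<close>)

lemma lgl_line_in_points:
  assumes c: "c \<in> coords S" and z: "z \<in> tnodes (deg S) (coords S - {c}) K"
    and s: "s \<in> lgl_nodes (nlgl S) (fst K $ c) (snd K $ c)"
  shows "upd z c s \<in> points S K"
proof -
  have "upd z c s \<in> tnodes_lgl (deg S) (nlgl S) (coords S) c K"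
    using z s c by (auto simp: tnodes_lgl_def tnodes_def upd_nth)
  then show ?thesis using c by (auto simp: points_def all_points_def)
qed

lemma face_in_lgl_nodes: "face K c up \<in> lgl_nodes n (fst K $ c) (snd K $ c)"
  by (simp add: face_def lgl_nodes_ends)

lemma face_node_in_points:
  assumes "c \<in> coords S" "z \<in> tnodes (deg S) (coords S - {c}) K"
  shows "upd z c (face K c up) \<in> points S K"
  by (rule lgl_line_in_points[OF assms face_in_lgl_nodes])

lemma tnodes_in_points: "z \<in> tnodes (deg S) (coords S) K \<Longrightarrow> z \<in> points S K"
  by (simp add: points_def all_points_def)


section \<open>Number fluxes through the faces of an element\<close>

text \<open>The local Lax--Friedrichs form, with the dissipation taken on conserved moments for the
  normal velocity, makes the density flux split into factors that are nonnegative on the cone.\<close>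

lemma spatial_flux_density:
  "fst (Fx cl i w Ma + Fx cl i w Mb - (conserved cl (axis i (w $ i)) Mb - conserved cl (axis i (w $ i)) Ma))
    = (1 + w $ i) * (fst Ma + snd Ma $ i) - (1 - w $ i) * (fst Mb - snd Mb $ i)"
  by (simp add: Fx_def conserved_def inner_axis' algebra_simps)

lemma cone_component:
  assumes "gam M \<ge> 0"
  shows "\<bar>snd M $ i\<bar> \<le> fst M"
  using assms component_le_norm_cart[of "snd M" i] by (simp add: gam_def)

text \<open>The data of the advection step that determine the signs of the face fluxes.\<close>

locale advection_data =
  fixes S :: dgdata and U :: "cell \<Rightarrow> point \<Rightarrow> moments"
  assumes mesh: "mesh S"
    and exact: "exact_closure (clos S)"
    and primitive: "\<And>B w u. B \<in> xmesh S \<Longrightarrow> w \<in> velocities S B \<Longrightarrow> u \<in> realizable \<Longrightarrow>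
      is_primitive (clos S) u w (prim S u w)"
    and subluminal: "\<And>B w. B \<in> xmesh S \<Longrightarrow> w \<in> velocities S B \<Longrightarrow> norm w < 1"
    and boundary: "boundary_realizable S"
    and init: "\<And>K z. K \<in> cells S \<Longrightarrow> z \<in> points S K \<Longrightarrow> U K z \<in> realizable"
begin

text \<open>The neighbour shares the tangential nodes of the face, so the outer trace is again taken at
  one of its Lobatto points.\<close>

lemma outer_trace_realizable:
  assumes K: "K \<in> cells S" and c: "c \<in> coords S"
    and z: "z \<in> tnodes (deg S) (coords S - {c}) K"
  shows "outer (cells S) U (bU S) K c up (upd z c (face K c up)) \<in> realizable"
proof (cases "\<exists>K'\<in>cells S. adjacent K c up K'")
  case True
  define K' where "K' = (SOME K'. K' \<in> cells S \<and> adjacent K c up K')"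
  have K': "K' \<in> cells S" "adjacent K c up K'"
    using someI_ex[of "\<lambda>K'. K' \<in> cells S \<and> adjacent K c up K'"] True
    unfolding K'_def by blast+
  have "z \<in> tnodes (deg S) (coords S - {c}) K'"
    using z K'(2) by (auto simp: tnodes_def adjacent_def)
  then have "upd z c (face K' c (\<not> up)) \<in> points S K'" by (rule face_node_in_points[OF c])
  moreover have "face K' c (\<not> up) = face K c up" using K'(2) by (simp add: adjacent_def)
  ultimately have "U K' (upd z c (face K c up)) \<in> realizable" using init[OF K'(1)] by simp
  then show ?thesis using True by (simp add: outer_def K'_def)
next
  case False
  then show ?thesis
    using boundary K c z by (simp add: outer_def boundary_realizable_def)
qed

lemma primitive_of_realizable:
  assumes B: "B \<in> xmesh S" and w: "w \<in> velocities S B" and u: "u \<in> realizable"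
  shows "gam (prim S u w) \<ge> 0" and "fst u = fst (prim S u w) + w \<bullet> snd (prim S u w)"
    and "(1 - norm w) * fst (prim S u w) \<le> fst u"
proof -
  have prim: "is_primitive (clos S) u w (prim S u w)" by (rule primitive[OF B w u])
  then have eq: "conserved (clos S) w (prim S u w) = u" by (simp add: is_primitive_def)
  show g: "gam (prim S u w) \<ge> 0" by (rule primitive_cone[OF exact realizable_cone[OF u] prim])
  show "fst u = fst (prim S u w) + w \<bullet> snd (prim S u w)"
    by (subst eq[symmetric]) (simp add: conserved_def)
  show "(1 - norm w) * fst (prim S u w) \<le> fst u"
    using conserved_density_ge[OF g, of w "clos S"] unfolding eq .
qed

text \<open>The trace from outside contributes only inflow; the outflow is bounded by the density
  inside.\<close>

lemma spatial_flux_le: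
  assumes K: "K \<in> cells S" and i: "i \<in> xdims S"
    and z0: "z0 \<in> tnodes (deg S) (coords S - {Some i}) K"
    and z: "z = upd z0 (Some i) (face K (Some i) up)"
    and dt: "0 < dt" and c: "0 \<le> c"
    and cfl: "\<And>w. w \<in> velocities S (sbox K) \<Longrightarrow> dt \<le> (1 - norm w) * c"
  shows "dt * ((if up then 1 else -1) * fst (flux_x S U K i up z)) \<le> c * fst (U K z)"
proof -
  have ci: "Some i \<in> coords S" using i by (simp add: Some_in_coords)
  define w where "w = vhat S (sbox K) i up (spat z)"
  define Uo where "Uo = outer (cells S) U (bU S) K (Some i) up z"
  define Min where "Min = prim S (U K z) w"
  define Mout where "Mout = prim S Uo w"
  have B: "sbox K \<in> xmesh S" by (rule cell_geometry(1)[OF mesh K])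
  have box: "spat z \<in> closed_box (sbox K)"
    unfolding z by (rule face_node_in_closed_box[OF mesh K ci z0])
  have "spat z $ Some i = face (sbox K) (Some i) up"
    by (simp add: z spat_def upd_nth face_def sbox_def)
  with box i have w: "w \<in> velocities S (sbox K)" unfolding velocities_def w_def by blast
  have nw: "norm w < 1" by (rule subluminal[OF B w])
  have Uin: "U K z \<in> realizable" unfolding z by (rule init[OF K face_node_in_points[OF ci z0]])
  have Uout: "Uo \<in> realizable"
    unfolding Uo_def z by (rule outer_trace_realizable[OF K ci z0])
  note Pin = primitive_of_realizable[OF B w Uin, folded Min_def]
  note Pout = primitive_of_realizable[OF B w Uout, folded Mout_def]
  define sg :: real where "sg = (if up then 1 else -1)"
  have sg: "sg = 1 \<or> sg = -1" by (simp add: sg_def)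
  have wi: "\<bar>w $ i\<bar> \<le> 1" using component_le_norm_cart[of w i] nw by simp
  have flux: "sg * fst (flux_x S U K i up z)
      = (1 + sg * w $ i) * (fst Min + sg * snd Min $ i) / 2
        - (1 - sg * w $ i) * (fst Mout - sg * snd Mout $ i) / 2"
    unfolding flux_x_def Let_def w_def[symmetric] Uo_def[symmetric] fst_scaleR spatial_flux_density
    by (cases up) (simp_all add: sg_def Min_def Mout_def field_simps)
  have "(1 - sg * w $ i) * (fst Mout - sg * snd Mout $ i) / 2 \<ge> 0"
    using cone_component[OF Pout(1), of i] wi sg by (auto intro!: mult_nonneg_nonneg simp: abs_le_iff)
  then have le: "sg * fst (flux_x S U K i up z)
      \<le> (1 + sg * w $ i) * (fst Min + sg * snd Min $ i) / 2" (is "_ \<le> ?out")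
    unfolding flux by linarith
  have out0: "?out \<ge> 0"
    using cone_component[OF Pin(1), of i] wi sg by (auto intro!: mult_nonneg_nonneg simp: abs_le_iff)
  have "dt * (sg * fst (flux_x S U K i up z)) \<le> dt * ?out"
    using le dt by (intro mult_left_mono) auto
  also have "\<dots> \<le> (1 - norm w) * c * ?out"
    using cfl[OF w] out0 by (rule mult_right_mono)
  also have "\<dots> = c * ((1 - norm w) * ?out)" by simp
  also have "\<dots> \<le> c * fst (U K z)"
    unfolding Pin(2) using outflow_le_density[OF Pin(1) _ sg, of w i] nw c
    by (intro mult_left_mono) auto
  finally show ?thesis by (simp add: sg_def)
qed

text \<open>The dissipation \<open>alpha_eps\<close> turns the contribution of the outer trace into inflow and
  bounds the outflow by \<open>alpha_eps\<close> times the inner density. The factor \<open>\<epsilon>\<^sup>3\<close> exceeds the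
  weight \<open>tau\<close> by the factor \<open>\<epsilon>\<close>, which is at most the upper end of the energy interval;
  this explains the division by it in the time step restriction.\<close>

lemma energy_flux_le:
  assumes K: "K \<in> cells S"
    and z0: "z0 \<in> tnodes (deg S) (coords S - {None}) K"
    and z: "z = upd z0 None (face K None up)"
    and dt: "0 < dt" and c: "0 \<le> c"
    and cfl: "\<And>x. x \<in> closed_box (sbox K) \<Longrightarrow>
      dt * alpha_eps (dvel S (sbox K) x) * snd K $ None \<le> (1 - norm (vel S (sbox K) x)) * c"
  shows "dt * ((if up then 1 else -1) * (z $ None ^ 3 * fst (flux_eps S U K up z)))
    \<le> c * (tau z * fst (U K z))"
proof -
  define w where "w = vel S (sbox K) (spat z)"
  define dv where "dv = dvel S (sbox K) (spat z)"
  define Uo where "Uo = outer (cells S) U (bU S) K None up z"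
  define Min where "Min = prim S (U K z) w"
  define Mout where "Mout = prim S Uo w"
  note cN = None_in_coords[of S]
  have B: "sbox K \<in> xmesh S" by (rule cell_geometry(1)[OF mesh K])
  have box: "spat z \<in> closed_box (sbox K)"
    unfolding z by (rule face_node_in_closed_box[OF mesh K cN z0])
  then have w: "w \<in> velocities S (sbox K)" unfolding velocities_def w_def by blast
  have Uin: "U K z \<in> realizable" unfolding z by (rule init[OF K face_node_in_points[OF cN z0]])
  have Uout: "Uo \<in> realizable"
    unfolding Uo_def z by (rule outer_trace_realizable[OF K cN z0])
  note Pin = primitive_of_realizable[OF B w Uin, folded Min_def]
  note Pout = primitive_of_realizable[OF B w Uout, folded Mout_def]
  define sg :: real where "sg = (if up then 1 else -1)"
  define al where "al = alpha_eps dv"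
  have flux: "sg * fst (flux_eps S U K up z)
      = (sg * fst (Feps (clos S) dv Min) + al * fst Min) / 2
        + (sg * fst (Feps (clos S) dv Mout) - al * fst Mout) / 2"
    unfolding flux_eps_def Let_def w_def[symmetric] dv_def[symmetric] Uo_def[symmetric] al_def
    by (cases up) (simp_all add: sg_def Min_def Mout_def field_simps)
  have le: "sg * fst (flux_eps S U K up z) \<le> al * fst Min"
    using energy_flux_bound[OF exact Pin(1), of dv] energy_flux_bound[OF exact Pout(1), of dv]
    unfolding flux al_def[symmetric] by (auto simp: sg_def abs_le_iff field_simps)
  define e where "e = z $ None"
  have e: "0 \<le> e" "e \<le> snd K $ None"
    using cell_geometry(2)[OF mesh K cN] cell_geometry(4)[OF mesh K]
    by (auto simp: e_def z upd_nth face_def)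
  have D: "fst Min \<ge> 0" by (rule cone_fst_nonneg[OF Pin(1)])
  have al: "al \<ge> 0" by (simp add: al_def alpha_eps_nonneg)
  have "dt * (sg * (e ^ 3 * fst (flux_eps S U K up z)))
      = (dt * e ^ 3) * (sg * fst (flux_eps S U K up z))" by simp
  also have "\<dots> \<le> (dt * e ^ 3) * (al * fst Min)"
    using le dt e by (intro mult_left_mono) auto
  also have "\<dots> = e\<^sup>2 * fst Min * (dt * al * e)" by (simp add: power3_eq_cube power2_eq_square)
  also have "\<dots> \<le> e\<^sup>2 * fst Min * (dt * al * snd K $ None)"
    using dt e D al by (intro mult_left_mono) auto
  also have "\<dots> \<le> e\<^sup>2 * fst Min * ((1 - norm w) * c)"
    using cfl[OF box] D unfolding al_def dv_def w_def by (intro mult_left_mono) auto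
  also have "\<dots> = c * (e\<^sup>2 * ((1 - norm w) * fst Min))" by simp
  also have "\<dots> \<le> c * (e\<^sup>2 * fst (U K z))"
    using Pin(3) c by (intro mult_left_mono) auto
  finally show ?thesis by (simp add: sg_def e_def tau_def)
qed


section \<open>Nonnegative cell averages after advection\<close>

lemma pd_const: "pd c (\<lambda>_. 1) = (\<lambda>_. 0)"
  by (simp add: pd_def fun_eq_iff)

lemma fst_Bh_const:
  "fst (Bh S U (\<lambda>_. 1) K) =
    - (\<Sum>i\<in>xdims S.
        fquad (deg S) (coords S) K (Some i) True (\<lambda>z. tau z * fst (flux_x S U K i True z))
      - fquad (deg S) (coords S) K (Some i) False (\<lambda>z. tau z * fst (flux_x S U K i False z)))
    - (fquad (deg S) (coords S) K None True (\<lambda>z. z $ None ^ 3 * fst (flux_eps S U K True z))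
      - fquad (deg S) (coords S) K None False (\<lambda>z. z $ None ^ 3 * fst (flux_eps S U K False z)))"
  by (simp add: Bh_def Let_def pd_const ip_def fst_tquad fquad_def fst_sum tquad_0 Ssrc_def)

text \<open>The element mass is split into the shares \<open>gx * beta i\<close>, \<open>ge\<close> and \<open>gS\<close>. The first two
  kinds pay for the outflow in the individual directions, the last one remains.\<close>

lemma advected_density_nonneg:
  assumes lgl: "2 * nlgl S \<ge> deg S + 5"
    and constants: "gx > 0" "ge > 0" "gS > 0" "gx + ge + gS = 1"
      "\<And>i. i \<in> xdims S \<Longrightarrow> beta i > 0" "(\<Sum>i\<in>xdims S. beta i) = 1"
    and poly: "moments_poly (deg S) (coords S) (U K)"
    and dt: "tstep S > 0"
    and cfl_x: "\<And>K i w. K \<in> cells S \<Longrightarrow> i \<in> xdims S \<Longrightarrow> w \<in> velocities S (sbox K) \<Longrightarrow>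
      tstep S \<le> (1 - norm w) * (gx * beta i * lgl_end_weight (nlgl S) * width K (Some i))"
    and cfl_e: "\<And>K x. K \<in> cells S \<Longrightarrow> x \<in> closed_box (sbox K) \<Longrightarrow>
      tstep S * alpha_eps (dvel S (sbox K) x) * snd K $ None
        \<le> (1 - norm (vel S (sbox K) x)) * (ge * lgl_end_weight (nlgl S) * width K None)"
    and step: "advection_step S U V" and K: "K \<in> cells S"
  shows "fst (cell_avg (deg S) (coords S) K (V K)) \<ge> 0"
proof -
  let ?k = "deg S" and ?C = "coords S" and ?n = "nlgl S"
  let ?p = "\<lambda>z. fst (U K z)"
  let ?Q = "tquad ?k ?C K (\<lambda>z. tau z * ?p z)"
  define Fl where "Fl c up z = (case c of Some i \<Rightarrow> tau z * fst (flux_x S U K i up z)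
    | None \<Rightarrow> z $ None ^ 3 * fst (flux_eps S U K up z))" for c :: coord and up z
  note geo = cell_geometry[OF mesh K]
  have ew: "lgl_end_weight ?n > 0" using lgl by (intro lgl_end_weight_pos) simp
  have wd: "width K c > 0" if "c \<in> ?C" for c using geo(2)[OF that] by (simp add: width_def)
  have p: "tensor_poly ?k ?C ?p" using poly by (simp add: moments_poly_def)
  have nn: "?p (upd z c s) \<ge> 0"
    if "c \<in> ?C" "z \<in> tnodes ?k (?C - {c}) K" "s \<in> lgl_nodes ?n (fst K $ c) (snd K $ c)" for c z s
    using init[OF K lgl_line_in_points[OF that]] by (simp add: realizable_def)
  have Q0: "?Q \<ge> 0"
  proof -
    have "tau z * ?p z \<ge> 0" if "z \<in> tnodes ?k ?C K" for z
      using init[OF K tnodes_in_points[OF that]] by (simp add: realizable_def tau_def)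
    then have "tquad ?k ?C K (\<lambda>z. 0 :: real) \<le> ?Q" using geo(2) by (intro tquad_mono) auto
    then show ?thesis by (simp add: tquad_0)
  qed
  have space: "tstep S * (fquad ?k ?C K (Some i) True (Fl (Some i) True)
      - fquad ?k ?C K (Some i) False (Fl (Some i) False)) \<le> (gx * beta i) * ?Q"
    if i: "i \<in> xdims S" for i
  proof (rule face_balance[OF geo(2) geo(4) _ lgl p nn])
    show c: "Some i \<in> ?C" using i by (simp add: Some_in_coords)
    show g0: "gx * beta i \<ge> 0" using constants i by (simp add: less_imp_le)
    fix z0 up assume z0: "z0 \<in> tnodes ?k (?C - {Some i}) K"
    define z where "z = upd z0 (Some i) (face K (Some i) up)"
    let ?G = "gx * beta i * lgl_end_weight ?n * width K (Some i)"
    have "tstep S * ((if up then 1 else -1) * fst (flux_x S U K i up z)) \<le> ?G * ?p z"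
      using cfl_x[OF K i] g0 ew wd[OF c]
      by (intro spatial_flux_le[OF K i z0 z_def dt]) auto
    then have "tau z * (tstep S * ((if up then 1 else -1) * fst (flux_x S U K i up z)))
        \<le> tau z * (?G * ?p z)"
      by (intro mult_left_mono) (auto simp: tau_def)
    then show "tstep S * ((if up then 1 else -1) * Fl (Some i) up (upd z0 (Some i) (face K (Some i) up)))
        \<le> ?G * (tau (upd z0 (Some i) (face K (Some i) up)) * ?p (upd z0 (Some i) (face K (Some i) up)))"
      unfolding z_def[symmetric] by (simp add: Fl_def algebra_simps)
  qed (use Some_in_coords i in auto)
  have energy: "tstep S * (fquad ?k ?C K None True (Fl None True)
      - fquad ?k ?C K None False (Fl None False)) \<le> ge * ?Q"
  proof (rule face_balance[OF geo(2) geo(4) None_in_coords lgl p nn[OF None_in_coords]])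
    show "ge \<ge> 0" using constants by simp
    fix z0 up assume z0: "z0 \<in> tnodes ?k (?C - {None}) K"
    show "tstep S * ((if up then 1 else -1) * Fl None up (upd z0 None (face K None up)))
        \<le> ge * lgl_end_weight ?n * width K None *
          (tau (upd z0 None (face K None up)) * ?p (upd z0 None (face K None up)))"
      using energy_flux_le[OF K z0 refl dt _ cfl_e[OF K]]
        constants ew wd[OF None_in_coords]
      by (simp add: Fl_def)
  qed auto
  have "tstep S * fst (Bh S U (\<lambda>_. 1) K) =
      - (\<Sum>i\<in>xdims S. tstep S * (fquad ?k ?C K (Some i) True (Fl (Some i) True)
          - fquad ?k ?C K (Some i) False (Fl (Some i) False)))
      - tstep S * (fquad ?k ?C K None True (Fl None True) - fquad ?k ?C K None False (Fl None False))"
  proof -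
    have "Fl (Some i) up = (\<lambda>z. tau z * fst (flux_x S U K i up z))"
      "Fl None up = (\<lambda>z. z $ None ^ 3 * fst (flux_eps S U K up z))" for i up
      by (simp_all add: Fl_def fun_eq_iff)
    then show ?thesis by (simp add: fst_Bh_const sum_distrib_left right_diff_distrib)
  qed
  also have "\<dots> \<ge> - (\<Sum>i\<in>xdims S. (gx * beta i) * ?Q) - ge * ?Q"
    using sum_mono[OF space] energy by (intro diff_mono) auto
  also (xtrans) have "- (\<Sum>i\<in>xdims S. (gx * beta i) * ?Q) - ge * ?Q = - (gx + ge) * ?Q"
  proof -
    have "(\<Sum>i\<in>xdims S. (gx * beta i) * ?Q) = gx * ?Q * (\<Sum>i\<in>xdims S. beta i)"
      unfolding sum_distrib_left by (intro sum.cong refl) simp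
    then show ?thesis using constants by (simp add: algebra_simps)
  qed
  finally have B: "tstep S * fst (Bh S U (\<lambda>_. 1) K) \<ge> - (gx + ge) * ?Q" .
  have "ip ?k ?C K (V K) (\<lambda>_. 1) = ip ?k ?C K (U K) (\<lambda>_. 1) + tstep S *\<^sub>R Bh S U (\<lambda>_. 1) K"
    using step K tensor_poly_const unfolding advection_step_def by blast
  then have "fst (ip ?k ?C K (V K) (\<lambda>_. 1)) = ?Q + tstep S * fst (Bh S U (\<lambda>_. 1) K)"
    by (simp add: ip_def fst_tquad)
  also have "\<dots> \<ge> gS * ?Q"
  proof -
    have gS: "gS = 1 - (gx + ge)" using constants by simp
    have "gS * ?Q = ?Q + - (gx + ge) * ?Q" unfolding gS by (simp add: algebra_simps)
    then show ?thesis using B by simp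
  qed
  finally have "fst (ip ?k ?C K (V K) (\<lambda>_. 1)) \<ge> gS * ?Q" .
  then have "fst (ip ?k ?C K (V K) (\<lambda>_. 1)) \<ge> 0"
    using constants Q0 by (meson mult_nonneg_nonneg less_imp_le order_trans)
  moreover have "tquad ?k ?C K tau \<ge> 0"
    using tquad_mono[of ?C K ?k "\<lambda>_. 0" tau] geo(2) by (simp add: tquad_0 tau_def)
  ultimately show ?thesis by (simp add: cell_avg_def)
qed

end


section \<open>The limiter\<close>

definition density_theta :: "dgdata \<Rightarrow> cell \<Rightarrow> (point \<Rightarrow> moments) \<Rightarrow> real" where
  "density_theta S K U = (let A = fst (cell_avg (deg S) (coords S) K U) in
     min (A / (A - Min ((\<lambda>z. fst (U z)) ` points S K))) 1)"

text \<open>The admissible parameters form a compact set containing 0, so that the largest one exists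
  and is itself admissible.\<close>

lemma limiter_realizable_average:
  fixes S :: dgdata and K :: cell and U :: "point \<Rightarrow> moments"
  defines "A \<equiv> cell_avg (deg S) (coords S) K U" and "thN \<equiv> density_theta S K U"
  assumes A: "A \<in> realizable"
  obtains th where "0 \<le> th" "th \<le> 1"
    "\<And>z. limiter S K U z = th *\<^sub>R (thN * fst (U z) + (1 - thN) * fst A, snd (U z)) + (1 - th) *\<^sub>R A"
    "\<And>z. z \<in> points S K \<Longrightarrow> gam (limiter S K U z) \<ge> 0"
proof -
  define V where "V z = (thN * fst (U z) + (1 - thN) * fst A, snd (U z))" for z
  define P where "P th \<longleftrightarrow> 0 \<le> th \<and> th \<le> 1 \<and>
    (\<forall>z\<in>points S K. gam (th *\<^sub>R V z + (1 - th) *\<^sub>R A) \<ge> 0)" for th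
  have lim: "limiter S K U z = Greatest P *\<^sub>R V z + (1 - Greatest P) *\<^sub>R A" for z
    using A
    by (simp add: limiter_def density_theta_def thN_def Let_def A_def V_def P_def[abs_def])
  have "{th. P th} = {0..1} \<inter> (\<Inter>z\<in>points S K. {th. gam (th *\<^sub>R V z + (1 - th) *\<^sub>R A) \<ge> 0})"
    by (auto simp: P_def)
  moreover have "closed {th. gam (th *\<^sub>R V z + (1 - th) *\<^sub>R A) \<ge> 0}" for z
    unfolding gam_def by (intro closed_Collect_le continuous_intros)
  ultimately have "compact {th. P th}" by (auto intro!: compact_Int_closed)
  moreover have "P 0" using realizable_cone[OF A] by (simp add: P_def)
  ultimately obtain th where "P th" "\<And>t. P t \<Longrightarrow> t \<le> th"
    using compact_attains_sup[of "{th. P th}"] by auto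
  then have "P (Greatest P)" by (rule GreatestI2_order) auto
  then show thesis using lim by (intro that[of "Greatest P"]) (auto simp: P_def V_def)
qed

lemma limiter_unrealizable_average:
  assumes "cell_avg (deg S) (coords S) K U \<notin> realizable"
    and A: "fst (cell_avg (deg S) (coords S) K U) \<ge> 0" and d: "0 < limpar S" "limpar S < 1"
  shows "fst (limiter S K U z) = fst (cell_avg (deg S) (coords S) K U)"
    and "gam (limiter S K U z) \<ge> 0"
proof -
  let ?A = "fst (cell_avg (deg S) (coords S) K U)"
  have lim: "limiter S K U z = (?A, ((1 - limpar S) * ?A / norm (snd (U z))) *\<^sub>R snd (U z))"
    using assms(1) by (simp add: limiter_def Let_def)
  then show "fst (limiter S K U z) = ?A" by simp
  have "norm (((1 - limpar S) * ?A / norm (snd (U z))) *\<^sub>R snd (U z)) \<le> (1 - limpar S) * ?A"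
    using A d by (cases "snd (U z) = 0") (simp_all add: abs_mult)
  also have "\<dots> \<le> ?A" using A d by (simp add: algebra_simps)
  finally show "gam (limiter S K U z) \<ge> 0" by (simp add: lim gam_def)
qed

lemma limiter_cone:
  assumes "fst (cell_avg (deg S) (coords S) K U) \<ge> 0"
    and "0 < limpar S" "limpar S < 1" and z: "z \<in> points S K"
  shows "gam (limiter S K U z) \<ge> 0"
proof (cases "cell_avg (deg S) (coords S) K U \<in> realizable")
  case True
  then show ?thesis by (rule limiter_realizable_average) (use z in blast)
qed (use limiter_unrealizable_average assms in blast)

text \<open>The scaling is chosen such that the minimum \<open>m\<close> is raised to 0 if it is negative. For
  \<open>m = a\<close> the quotient is \<open>a / 0 = 0\<close>, which leaves the average.\<close>

lemma limited_density_positive: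
  fixes a m N :: real
  assumes a: "a > 0" "m \<le> a" "m \<le> N"
  defines "t \<equiv> min (a / (a - m)) 1"
  shows "t * N + (1 - t) * a \<ge> 0" and "t * N + (1 - t) * a = 0 \<Longrightarrow> N \<le> 0"
proof -
  have t: "0 \<le> t" "t \<le> 1" using a by (simp_all add: t_def)
  have "t * (a - m) \<le> a"
  proof (cases "m = a")
    case False
    then have "t * (a - m) \<le> a / (a - m) * (a - m)"
      using a by (intro mult_right_mono) (auto simp: t_def)
    then show ?thesis using False by simp
  qed (use a in simp)
  moreover have "t * (a - N) \<le> t * (a - m)" using a t by (intro mult_left_mono) auto
  moreover have split: "t * N + (1 - t) * a = a - t * (a - N)" by (simp add: algebra_simps)
  ultimately show "t * N + (1 - t) * a \<ge> 0" by linarith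
  assume "t * N + (1 - t) * a = 0"
  then have eq: "t * (a - N) = a" using split by simp
  then have "a - N > 0" using a t by (smt (verit) mult_nonneg_nonpos)
  then have "t * (a - N) \<le> 1 * (a - N)" using t by (intro mult_right_mono) auto
  then show "N \<le> 0" using eq by simp
qed

text \<open>In the closed cone, a vanishing density can only mean the vertex 0. It can be reached only
  if the second scaling is trivial and the unlimited density is at most 0; but then the flux
  at this point is the unlimited one, which does not vanish.\<close>

lemma limiter_realizable:
  assumes A: "fst (cell_avg (deg S) (coords S) K U) > 0"
    and fin: "finite (points S K)"
    and min: "Min ((\<lambda>z. fst (U z)) ` points S K) \<le> fst (cell_avg (deg S) (coords S) K U)"
    and d: "0 < limpar S" "limpar S < 1" and z: "z \<in> points S K"
    and nd: "fst (U z) \<le> 0 \<Longrightarrow> snd (U z) \<noteq> 0"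
  shows "limiter S K U z \<in> realizable"
proof -
  let ?A = "cell_avg (deg S) (coords S) K U"
  have cone: "gam (limiter S K U z) \<ge> 0" using A by (intro limiter_cone[OF _ d z]) simp
  have "fst (limiter S K U z) \<noteq> 0"
  proof (cases "?A \<in> realizable")
    case False
    then show ?thesis using limiter_unrealizable_average(1)[OF False _ d] A by simp
  next
    case True
    define thN where "thN = density_theta S K U"
    define N where "N = thN * fst (U z) + (1 - thN) * fst ?A"
    from True obtain th where th: "0 \<le> th" "th \<le> 1"
        and lim: "limiter S K U z = th *\<^sub>R (N, snd (U z)) + (1 - th) *\<^sub>R ?A"
      unfolding N_def thN_def by (rule limiter_realizable_average) blast
    have "Min ((\<lambda>z. fst (U z)) ` points S K) \<le> fst (U z)" using fin z by (intro Min_le) auto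
    from limited_density_positive[OF A min this]
    have N: "N \<ge> 0" "N = 0 \<Longrightarrow> fst (U z) \<le> 0"
      unfolding N_def thN_def density_theta_def Let_def by simp_all
    show ?thesis
    proof
      assume zero: "fst (limiter S K U z) = 0"
      then have sum: "th * N + (1 - th) * fst ?A = 0" by (simp add: lim)
      have "th * N \<ge> 0" "(1 - th) * fst ?A \<ge> 0" using th N(1) A by simp_all
      then have "th * N = 0" "(1 - th) * fst ?A = 0" using sum by linarith+
      then have "th = 1" "N = 0" using A by auto
      then have "snd (limiter S K U z) \<noteq> 0" using nd N(2) by (simp add: lim)
      then show False using cone zero by (simp add: gam_def)
    qed
  qed
  then show ?thesis using cone cone_fst_nonneg[OF cone] by (simp add: realizable_def)
qed


section \<open>Nodal positivity after the collision step\<close>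

text \<open>For subluminal velocities the conserved density vanishes only together with the primitive
  moments, and then all conserved moments vanish.\<close>

lemma conserved_density_pos:
  assumes M: "gam M \<ge> 0" and w: "norm w < 1"
    and nd: "fst (conserved cl w M) \<le> 0 \<Longrightarrow> snd (conserved cl w M) \<noteq> 0"
  shows "fst (conserved cl w M) > 0"
proof (rule ccontr)
  assume "\<not> fst (conserved cl w M) > 0"
  then have le: "fst (conserved cl w M) \<le> 0" by simp
  then have "(1 - norm w) * fst M \<le> 0" using conserved_density_ge[OF M, of w cl] by simp
  then have "fst M = 0" using cone_fst_nonneg[OF M] w by (simp add: mult_le_0_iff)
  then have "snd M = 0" using M by (simp add: gam_def)
  with \<open>fst M = 0\<close> have "snd (conserved cl w M) = 0"
    by (simp add: conserved_def Kten_def vec_eq_iff)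
  with nd le show False by simp
qed

lemma collision_density_pos:
  assumes exact: "exact_closure (clos S)"
    and v: "norm (vel S (sbox K) (spat z)) < 1"
    and dt: "tstep S > 0" and op: "chiop S K \<ge> 0" "sigop S K \<ge> 0"
    and eq: "Deq S K z \<ge> 0"
    and step: "collision_step S U V" and K: "K \<in> cells S"
    and z: "z \<in> tnodes (deg S) (coords S) K" and U: "gam (U K z) \<ge> 0"
    and nd: "fst (V K z) \<le> 0 \<Longrightarrow> snd (V K z) \<noteq> 0"
  shows "fst (V K z) > 0"
proof -
  let ?w = "vel S (sbox K) (spat z)"
  obtain P where P: "\<And>K z. K \<in> cells S \<Longrightarrow> z \<in> tnodes (deg S) (coords S) K \<Longrightarrow>
      (\<exists>M0\<in>realizable.
        (\<lambda>n. (implicit_picard S (chiop S K) (chiop S K + sigop S K) (Deq S K z) (U K z)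
          (vel S (sbox K) (spat z)) ^^ n) M0) \<longlonglongrightarrow> P K z) \<and>
      V K z = conserved (clos S) (vel S (sbox K) (spat z)) (P K z)"
    using step unfolding collision_step_def by blast
  obtain M0 where M0: "M0 \<in> realizable"
      "(\<lambda>n. (implicit_picard S (chiop S K) (chiop S K + sigop S K) (Deq S K z) (U K z) ?w ^^ n) M0)
        \<longlonglongrightarrow> P K z"
    using P[OF K z] by blast
  have "gam (P K z) \<ge> 0"
  proof (rule iteration_limit_cone[OF _ M0])
    fix M assume M: "gam M \<ge> 0"
    show "gam (implicit_picard S (chiop S K) (chiop S K + sigop S K) (Deq S K z) (U K z) ?w M) \<ge> 0"
      using dt op eq by (intro implicit_picard_cone[OF exact _ _ _ _ U M]) auto
  qed
  then show ?thesis
    using conserved_density_pos[OF _ v] nd P[OF K z] by metis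
qed

lemma positive_nodes_average:
  fixes U :: "point \<Rightarrow> moments"
  assumes mesh: "mesh S" and K: "K \<in> cells S" and fin: "finite (points S K)"
    and pos: "\<And>z. z \<in> tnodes (deg S) (coords S) K \<Longrightarrow> fst (U z) > 0"
  shows "fst (cell_avg (deg S) (coords S) K U) > 0"
    and "Min ((\<lambda>z. fst (U z)) ` points S K) \<le> fst (cell_avg (deg S) (coords S) K U)"
proof -
  let ?k = "deg S" and ?C = "coords S"
  let ?m = "Min ((\<lambda>z. fst (U z)) ` points S K)"
  let ?T = "tquad ?k ?C K tau" and ?Q = "tquad ?k ?C K (\<lambda>z. tau z * fst (U z))"
  note geo = cell_geometry[OF mesh K]
  have tau: "tau z > 0" if z: "z \<in> tnodes ?k ?C K" for z
  proof -
    have "z $ None \<in> lg_nodes (?k + 1) (fst K $ None) (snd K $ None)"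
      using z None_in_coords by (simp add: tnodes_def)
    from lg_nodes_interior[OF geo(2)[OF None_in_coords] this] geo(4) show ?thesis
      by (simp add: tau_def)
  qed
  have T: "?T > 0" using tau geo(2) by (intro tquad_pos) auto
  have Q: "?Q > 0" using tau pos geo(2) by (intro tquad_pos mult_pos_pos) auto
  have avg: "fst (cell_avg ?k ?C K U) = ?Q / ?T"
    by (simp add: cell_avg_def ip_def fst_tquad)
  show "fst (cell_avg ?k ?C K U) > 0" unfolding avg using T Q by simp
  have "?m * ?T = tquad ?k ?C K (\<lambda>z. ?m * tau z)" by (simp add: tquad_scale)
  also have "\<dots> \<le> ?Q"
  proof (rule tquad_mono[OF geo(2)])
    fix z assume z: "z \<in> tnodes ?k ?C K"
    have "?m \<le> fst (U z)" using fin tnodes_in_points[OF z] by (intro Min_le) auto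
    then show "?m * tau z \<le> tau z * fst (U z)" using tau[OF z] by (simp add: mult.commute)
  qed auto
  finally show "?m \<le> fst (cell_avg ?k ?C K U)" unfolding avg using T by (simp add: pos_le_divide_eq)
qed


section \<open>One step of the scheme\<close>

lemma dt_x_le:
  assumes "ereal dt \<le> dt_x S gx beta" and "K \<in> cells S" "i \<in> xdims S" "w \<in> velocities S (sbox K)"
  shows "dt \<le> (1 - norm w) * (gx * beta i * lgl_end_weight (nlgl S) * width K (Some i))"
proof -
  have "dt_x S gx beta
      \<le> ereal ((1 - norm w) * (gx * beta i * lgl_end_weight (nlgl S)) * width K (Some i))"
    unfolding dt_x_def
    by (rule INF_lower2[OF assms(2)], rule INF_lower2[OF assms(3)], rule INF_lower[OF assms(4)])
  with assms(1) have "ereal dt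
      \<le> ereal ((1 - norm w) * (gx * beta i * lgl_end_weight (nlgl S)) * width K (Some i))"
    by (rule order_trans)
  then show ?thesis by (simp add: mult.assoc)
qed

text \<open>Multiplying by \<open>alpha_eps\<close> avoids the infinite value of the bound where \<open>alpha_eps = 0\<close>.\<close>

lemma dt_eps_le:
  assumes dt: "ereal dt \<le> dt_eps S ge" and K: "K \<in> cells S" and x: "x \<in> closed_box (sbox K)"
    and v: "norm (vel S (sbox K) x) \<le> 1" and pos: "0 \<le> ge * lgl_end_weight (nlgl S)"
      "0 \<le> width K None" "0 < snd K $ None"
  shows "dt * alpha_eps (dvel S (sbox K) x) * snd K $ None
    \<le> (1 - norm (vel S (sbox K) x)) * (ge * lgl_end_weight (nlgl S) * width K None)"
proof (cases "alpha_eps (dvel S (sbox K) x) = 0")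
  case True
  then show ?thesis using v pos by simp
next
  case False
  define al where "al = alpha_eps (dvel S (sbox K) x)"
  define r where "r = 1 - norm (vel S (sbox K) x)"
  define g where "g = ge * lgl_end_weight (nlgl S)"
  have al: "al > 0" using False alpha_eps_nonneg[of "dvel S (sbox K) x"] by (simp add: al_def)
  have "dt_eps S ge \<le> ereal r * (ereal g / ereal al) * ereal (width K None / snd K $ None)"
    unfolding dt_eps_def al_def r_def g_def
    by (rule INF_lower2[OF K], rule INF_lower[OF x])
  with dt have "ereal dt \<le> ereal r * (ereal g / ereal al) * ereal (width K None / snd K $ None)"
    by (rule order_trans)
  then have "dt \<le> r * (g / al) * (width K None / snd K $ None)" using al by simp
  then have "dt * (al * snd K $ None)
      \<le> r * (g / al) * (width K None / snd K $ None) * (al * snd K $ None)"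
    using al pos by (intro mult_right_mono) auto
  also have "\<dots> = r * (g * width K None)" using al pos by simp
  finally show ?thesis by (simp add: al_def r_def g_def mult.assoc)
qed

theorem theorem1:
  fixes S :: dgdata
    and gx ge gS :: real and beta :: "3 \<Rightarrow> real"
    and U0 V1 U1 V2 U2 :: "cell \<Rightarrow> point \<Rightarrow> moments"
  assumes mesh: "mesh S"
    and lgl: "real (nlgl S) \<ge> (real (deg S) + 5) / 2"
    and limpar: "0 < limpar S" "limpar S < 1"
    and constants: "gx > 0" "ge > 0" "gS > 0" "gx + ge + gS = 1"
      "\<And>i. i \<in> xdims S \<Longrightarrow> beta i > 0" "(\<Sum>i\<in>xdims S. beta i) = 1"
    and velocity: "velocity_space S" "discrete_gradient S"
    and opacities: "\<And>K. K \<in> cells S \<Longrightarrow> chiop S K \<ge> 0" "\<And>K. K \<in> cells S \<Longrightarrow> sigop S K \<ge> 0"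
    and equilibrium: "\<And>K z. K \<in> cells S \<Longrightarrow> z \<in> tnodes (deg S) (coords S) K \<Longrightarrow> Deq S K z \<ge> 0"
    and boundary: "boundary_realizable S"
    and primitive: "\<And>B w U. B \<in> xmesh S \<Longrightarrow> w \<in> velocities S B \<Longrightarrow> U \<in> realizable \<Longrightarrow>
      is_primitive (clos S) U w (prim S U w)"
    and step0: "\<And>K. K \<in> cells S \<Longrightarrow> moments_poly (deg S) (coords S) (U0 K)"
    and step1: "advection_step S U0 V1"
    and step2: "\<And>K. K \<in> cells S \<Longrightarrow> U1 K = limiter S K (V1 K)"
    and step3: "collision_step S U1 V2"
    and step4: "\<And>K. K \<in> cells S \<Longrightarrow> U2 K = limiter S K (V2 K)"
    and nondegenerate: "\<And>K z. K \<in> cells S \<Longrightarrow> z \<in> points S K \<Longrightarrow>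
      fst (V2 K z) \<le> 0 \<Longrightarrow> snd (V2 K z) \<noteq> 0"
    and exact: "exact_closure (clos S)"
    and subluminal: "\<And>B w. B \<in> xmesh S \<Longrightarrow> w \<in> velocities S B \<Longrightarrow> norm w < 1"
    and dt_pos: "tstep S > 0"
    and cfl: "ereal (tstep S) \<le> min (dt_x S gx beta) (dt_eps S ge)"
    and init: "\<And>K z. K \<in> cells S \<Longrightarrow> z \<in> points S K \<Longrightarrow> U0 K z \<in> realizable"
  shows "\<forall>K\<in>cells S. \<forall>z\<in>points S K. U2 K z \<in> realizable"
proof (intro ballI)
  fix K z assume K: "K \<in> cells S" and z: "z \<in> points S K"
  interpret advection_data S U0
    using mesh exact primitive subluminal boundary init by unfold_locales
  have "real (deg S + 5) \<le> real (2 * nlgl S)" using lgl by simp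
  then have n: "2 * nlgl S \<ge> deg S + 5" by (simp only: of_nat_le_iff)
  have fin: "finite (points S K)" unfolding points_def using n by (intro finite_all_points) simp
  have ew: "lgl_end_weight (nlgl S) > 0" using n by (intro lgl_end_weight_pos) simp
  have x: "tstep S \<le> (1 - norm w) * (gx * beta i * lgl_end_weight (nlgl S) * width K' (Some i))"
    if "K' \<in> cells S" "i \<in> xdims S" "w \<in> velocities S (sbox K')" for K' i w
    using cfl that by (intro dt_x_le) simp_all
  have vel_lt: "norm (vel S (sbox K') x) < 1"
    if K': "K' \<in> cells S" and x: "x \<in> closed_box (sbox K')" for K' x
  proof (rule subluminal[OF cell_geometry(1)[OF mesh K']])
    show "vel S (sbox K') x \<in> velocities S (sbox K')" using x by (simp add: velocities_def)
  qed
  have e: "tstep S * alpha_eps (dvel S (sbox K') x) * snd K' $ None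
      \<le> (1 - norm (vel S (sbox K') x)) * (ge * lgl_end_weight (nlgl S) * width K' None)"
    if K': "K' \<in> cells S" and x: "x \<in> closed_box (sbox K')" for K' x
  proof (rule dt_eps_le[OF _ K' x])
    show "norm (vel S (sbox K') x) \<le> 1" using vel_lt[OF K' x] by simp
    note cell_geometry(2)[OF mesh K' None_in_coords] cell_geometry(4)[OF mesh K']
    then show "0 \<le> width K' None" "0 < snd K' $ None" by (simp_all add: width_def)
  qed (use cfl constants ew in auto)
  have "fst (cell_avg (deg S) (coords S) K (V1 K)) \<ge> 0"
    by (rule advected_density_nonneg[OF n constants step0[OF K] dt_pos x e step1 K])
  then have U1: "gam (U1 K z') \<ge> 0" if "z' \<in> points S K" for z'
    unfolding step2[OF K] using limpar that by (rule limiter_cone)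
  have V2: "fst (V2 K z') > 0" if z': "z' \<in> tnodes (deg S) (coords S) K" for z'
    using collision_density_pos[OF exact vel_lt[OF K node_in_closed_box[OF mesh K z']] dt_pos opacities(1)[OF K] opacities(2)[OF K]
        equilibrium[OF K z'] step3 K z' U1[OF tnodes_in_points[OF z']]]
      nondegenerate[OF K tnodes_in_points[OF z']] by blast
  show "U2 K z \<in> realizable"
    unfolding step4[OF K]
  proof (rule limiter_realizable)
    note avg = positive_nodes_average[where U = "V2 K", OF mesh K fin V2]
    show "fst (cell_avg (deg S) (coords S) K (V2 K)) > 0" by (rule avg(1))
    show "Min ((\<lambda>z. fst (V2 K z)) ` points S K) \<le> fst (cell_avg (deg S) (coords S) K (V2 K))"
      by (rule avg(2))
    show "snd (V2 K z) \<noteq> 0" if "fst (V2 K z) \<le> 0" using that by (rule nondegenerate[OF K z])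
  qed (use fin limpar z in auto)
qed

end
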